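(* Let $\mathcal H$ and $\mathcal K$ be Hilbert spaces and let $A_1,A_2\in L(\mathcal H,\mathcal K)\setminus\{0\}$ be semi-Fredholm such that $\operatorname{nul}(A_1)=\operatorname{nul}(A_2)$ and $\operatorname{def}(A_1)=\operatorname{def}(A_2)$. If $A_j=Q_j|A_j|$ is the polar decomposition of $A_j$, $j=1,2$, then $$\|Q_1-Q_2\|\le\frac{4}{\sigma_1+\sigma_2}\,\|A_1-A_2\|,$$ where $\sigma_j$ denotes the smallest positive spectral value of $|A_j|=(A_j^*A_j)^{1/2}$, $j=1,2$.
   Context: All Hilbert spaces are complex and may be infinite-dimensional. $L(\mathcal H,\mathcal K)$ is the set of bounded linear operators from $\mathcal H$ to $\mathcal K$, and $\|\cdot\|$ is the operator norm. $R(A)$ and $N(A)$ denote the range and kernel of $A$. The symbol $\dim$ always means Hilbert space dimension (a finite or infinite cardinal). For $A\in L(\mathcal H,\mathcal K)$ put $\operatorname{nul}(A):=\dim N(A)$ and $\operatorname{def}(A):=\dim R(A)^\perp$. $A$ is called semi-Fredholm if $R(A)$ is closed and at least one of $\operatorname{nul}(A)$, $\operatorname{def}(A)$ is finite. The polar decomposition of $A$ is the unique representation $A=Q|A|$ with $|A|=(A^*A)^{1/2}$ and $Q\in L(\mathcal H,\mathcal K)$ a partial isometry (isometric on $N(Q)^\perp$) with $N(Q)=N(A)$. For $A\ne0$ with closed range, the smallest positive spectral value of $|A|$ is $\inf(\sigma(|A|)\setminus\{0\})$, where $\sigma(|A|)$ is the spectrum of $|A|$; it is known that this number is positive. *)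

theory Defs
  imports "HOL-Analysis.Analysis"
begin

unbundle cardinal_syntax

section \<open>Complex Hilbert spaces\<close>

text \<open>
  A complex inner product space is presented as its underlying real inner product space
  (with \<open>x \<bullet> y\<close> the real part of the complex inner product, so both induce the same norm)
  together with the complex scalar multiplication and the complex inner product, which is
  linear in its first argument.  The notions of norm, closed set, bounded linear map and
  operator norm are then those of the library.
\<close>

class complex_vector = real_vector +
  fixes scaleC :: "complex \<Rightarrow> 'a \<Rightarrow> 'a"  (infixr \<open>*\<^sub>C\<close> 75)
  assumes scaleC_add_right: "c *\<^sub>C (x + y) = c *\<^sub>C x + c *\<^sub>C y"
    and scaleC_add_left: "(c + d) *\<^sub>C x = c *\<^sub>C x + d *\<^sub>C x"
    and scaleC_scaleC: "c *\<^sub>C (d *\<^sub>C x) = (c * d) *\<^sub>C x"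
    and scaleC_of_real: "complex_of_real r *\<^sub>C x = r *\<^sub>R x"

class complex_inner = complex_vector + real_inner +
  fixes cinner :: "'a \<Rightarrow> 'a \<Rightarrow> complex"
  assumes cinner_commute: "cinner x y = cnj (cinner y x)"
    and cinner_add_left: "cinner (x + y) z = cinner x z + cinner y z"
    and cinner_scaleC_left: "cinner (c *\<^sub>C x) y = c * cinner x y"
    and Re_cinner: "Re (cinner x y) = x \<bullet> y"

class chilbert_space = complex_inner + complete_space

lemma cinner_self:
  fixes x :: "'a::complex_inner"
  shows "cinner x x = complex_of_real ((norm x)\<^sup>2)"
proof (rule complex_eqI)
  show "Re (cinner x x) = Re (complex_of_real ((norm x)\<^sup>2))"
    by (simp add: Re_cinner power2_norm_eq_inner)
  have "Im (cinner x x) = - Im (cinner x x)"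
    using arg_cong[OF cinner_commute[of x x], of Im] by simp
  then show "Im (cinner x x) = Im (complex_of_real ((norm x)\<^sup>2))"
    by simp
qed

instantiation complex :: chilbert_space
begin

definition scaleC_complex :: "complex \<Rightarrow> complex \<Rightarrow> complex" where
  "scaleC_complex c x = c * x"

definition cinner_complex :: "complex \<Rightarrow> complex \<Rightarrow> complex" where
  "cinner_complex x y = x * cnj y"

instance
  by standard
    (simp_all add: scaleC_complex_def cinner_complex_def algebra_simps inner_complex_def
      scaleR_conv_of_real)

end


section \<open>Subspaces and Hilbert space dimension\<close>

definition kernel :: "('a \<Rightarrow> 'b::zero) \<Rightarrow> 'a set" where
  "kernel A = {x. A x = 0}"

definition ortho_compl :: "'a::complex_inner set \<Rightarrow> 'a set" where
  "ortho_compl S = {y. \<forall>x\<in>S. cinner x y = 0}"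

definition orthonormal :: "'a::complex_inner set \<Rightarrow> bool" where
  "orthonormal B \<longleftrightarrow> (\<forall>x\<in>B. norm x = 1) \<and> (\<forall>x\<in>B. \<forall>y\<in>B. x \<noteq> y \<longrightarrow> cinner x y = 0)"

definition is_orthonormal_basis :: "'a::complex_inner set \<Rightarrow> 'a set \<Rightarrow> bool" where
  "is_orthonormal_basis S B \<longleftrightarrow> orthonormal B \<and> B \<subseteq> S \<and>
     (\<forall>B'. orthonormal B' \<and> B \<subseteq> B' \<and> B' \<subseteq> S \<longrightarrow> B' = B)"

text \<open>
  The Hilbert space dimension of a closed subspace, as a cardinal (a cardinal order in the sense
  of the library's BNF cardinals).  All orthonormal bases of a closed subspace are equipotent, so
  the choice does not matter up to \<open>=o\<close>.
\<close>

definition hilbert_dim :: "'a::complex_inner set \<Rightarrow> 'a rel" where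
  "hilbert_dim S = |SOME B. is_orthonormal_basis S B|"


section \<open>Bounded operators\<close>

definition bounded_clinear :: "('a::complex_inner \<Rightarrow> 'b::complex_inner) \<Rightarrow> bool" where
  "bounded_clinear A \<longleftrightarrow> bounded_linear A \<and> (\<forall>c x. A (c *\<^sub>C x) = c *\<^sub>C A x)"

definition nul :: "('a::complex_inner \<Rightarrow> 'b::complex_inner) \<Rightarrow> 'a rel" where
  "nul A = hilbert_dim (kernel A)"

definition deficiency :: "('a::complex_inner \<Rightarrow> 'b::complex_inner) \<Rightarrow> 'b rel" where
  "deficiency A = hilbert_dim (ortho_compl (range A))"

definition semi_fredholm :: "('a::complex_inner \<Rightarrow> 'b::complex_inner) \<Rightarrow> bool" where
  "semi_fredholm A \<longleftrightarrow> bounded_clinear A \<and> closed (range A) \<and>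
     (finite (Field (nul A)) \<or> finite (Field (deficiency A)))"

text \<open>
  For a bounded operator between Hilbert spaces exactly one map satisfies the following condition;
  it is again a bounded operator.
\<close>

definition cadjoint :: "('a::complex_inner \<Rightarrow> 'b::complex_inner) \<Rightarrow> 'b \<Rightarrow> 'a" where
  "cadjoint A = (SOME B. \<forall>x y. cinner (A x) y = cinner x (B y))"

definition positive_operator :: "('a::complex_inner \<Rightarrow> 'a) \<Rightarrow> bool" where
  "positive_operator T \<longleftrightarrow> bounded_clinear T \<and> (\<forall>x. cinner (T x) x \<in> \<real>\<^sub>\<ge>\<^sub>0)"

text \<open>The positive square root of a positive operator on a Hilbert space exists and is unique.\<close>

definition operator_sqrt :: "('a::complex_inner \<Rightarrow> 'a) \<Rightarrow> 'a \<Rightarrow> 'a" where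
  "operator_sqrt T = (SOME P. positive_operator P \<and> P \<circ> P = T)"

definition operator_abs :: "('a::complex_inner \<Rightarrow> 'b::complex_inner) \<Rightarrow> 'a \<Rightarrow> 'a" where
  "operator_abs A = operator_sqrt (cadjoint A \<circ> A)"

definition partial_isometry :: "('a::complex_inner \<Rightarrow> 'b::complex_inner) \<Rightarrow> bool" where
  "partial_isometry Q \<longleftrightarrow> bounded_clinear Q \<and> (\<forall>x\<in>ortho_compl (kernel Q). norm (Q x) = norm x)"

definition polar_decomposition ::
  "('a::complex_inner \<Rightarrow> 'b::complex_inner) \<Rightarrow> ('a \<Rightarrow> 'b) \<Rightarrow> bool" where
  "polar_decomposition A Q \<longleftrightarrow>
     partial_isometry Q \<and> kernel Q = kernel A \<and> A = Q \<circ> operator_abs A"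

definition op_spectrum :: "('a::complex_inner \<Rightarrow> 'a) \<Rightarrow> complex set" where
  "op_spectrum T = {z. \<not> (\<exists>S. bounded_clinear S \<and>
      S \<circ> (\<lambda>x. T x - z *\<^sub>C x) = id \<and> (\<lambda>x. T x - z *\<^sub>C x) \<circ> S = id)}"

text \<open>
  Intended for positive operators, whose spectrum consists of nonnegative real numbers; the set
  below is then the spectrum without \<open>0\<close>, viewed inside the reals.
\<close>

definition min_pos_spectral_value :: "('a::complex_inner \<Rightarrow> 'a) \<Rightarrow> real" where
  "min_pos_spectral_value T = Inf {t. complex_of_real t \<in> op_spectrum T - {0}}"

end

theory Submission
  imports Defs
begin

text \<open>
  Let \<open>N\<^sub>j\<close> be the kernel of \<open>A\<^sub>j\<close>, \<open>H\<^sub>j = |A\<^sub>j|\<close>, \<open>D = \<parallel>A\<^sub>1 - A\<^sub>2\<parallel>\<close>, and \<open>R\<^sub>j\<close> the projection onto the range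
  of \<open>A\<^sub>j\<close>; by symmetry let \<open>\<sigma>\<^sub>2 \<le> \<sigma>\<^sub>1\<close>, and put \<open>k = 2 D / (\<sigma>\<^sub>1 + \<sigma>\<^sub>2) \<ge> D / \<sigma>\<^sub>1\<close>.  The operator
  \<open>Y = Q\<^sub>2\<^sup>* Q\<^sub>1 - 1\<close>, compressed to a map from \<open>N\<^sub>1\<^sup>\<bottom>\<close> to \<open>N\<^sub>2\<^sup>\<bottom>\<close>, solves the Sylvester equation
  \<open>Y H\<^sub>1 + H\<^sub>2 Y = Q\<^sub>2\<^sup>* (A\<^sub>1 - A\<^sub>2) - (A\<^sub>1 - A\<^sub>2)\<^sup>* Q\<^sub>1\<close>, and since \<open>H\<^sub>j \<ge> \<sigma>\<^sub>j\<close> on \<open>N\<^sub>j\<^sup>\<bottom>\<close> its norm is at most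
  \<open>k\<close>.  What is left of \<open>Q\<^sub>1 - Q\<^sub>2\<close> is \<open>(1 - R\<^sub>2) Q\<^sub>1\<close> on \<open>N\<^sub>1\<^sup>\<bottom>\<close> and \<open>- Q\<^sub>2\<close> on \<open>N\<^sub>1\<close>, with orthogonal ranges.
  The norms of \<open>(1 - R\<^sub>2) Q\<^sub>1\<close> on \<open>N\<^sub>1\<^sup>\<bottom>\<close> and of \<open>Q\<^sub>1\<close> on \<open>N\<^sub>2\<close> are at most \<open>D / \<sigma>\<^sub>1\<close>, because \<open>A\<^sub>2\<close>
  contributes nothing to them.  If the nullities are finite and equal, then \<open>Q\<^sub>2\<close> on \<open>N\<^sub>1\<close> obeys the same
  bound as \<open>Q\<^sub>1\<close> on \<open>N\<^sub>2\<close>; if the deficiencies are, then the two operators are exchanged in this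
  decomposition and \<open>(1 - R\<^sub>1) R\<^sub>2\<close> obeys the same bound as \<open>(1 - R\<^sub>2) R\<^sub>1\<close>.  Both parts of \<open>Q\<^sub>1 - Q\<^sub>2\<close>
  thus have norm at most \<open>k\<close>, which gives \<open>2 k\<close> in total.
\<close>

section \<open>Projections and adjoints in real Hilbert spaces\<close>

text \<open>For a closed subspace of a complete space, \<open>projection_exists\<close> and
  \<open>proj_eqI\<close> show that the choice exists and is unique.\<close>

definition proj :: "'a::real_inner set \<Rightarrow> 'a \<Rightarrow> 'a" where
  "proj M x = (SOME p. p \<in> M \<and> (\<forall>m\<in>M. (x - p) \<bullet> m = 0))"

lemma projection_exists:
  fixes M :: "'a::{real_inner,banach} set"
  assumes "subspace M" "closed M"
  shows "\<exists>p\<in>M. \<forall>m\<in>M. (x - p) \<bullet> m = 0"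
proof -
  define d where "d = Inf ((\<lambda>y. (norm (x - y))\<^sup>2) ` M)"
  have ne: "M \<noteq> {}" using subspace_0[OF assms(1)] by auto
  have bdd: "bdd_below ((\<lambda>y. (norm (x - y))\<^sup>2) ` M)" by (rule bdd_belowI[of _ 0]) auto
  have low: "d \<le> (norm (x - y))\<^sup>2" if "y \<in> M" for y
    unfolding d_def using cINF_lower[OF bdd that] .
  have "\<exists>y\<in>M. (norm (x - y))\<^sup>2 < d + 1 / real (Suc n)" for n
  proof -
    have "Inf ((\<lambda>y. (norm (x - y))\<^sup>2) ` M) < d + 1 / real (Suc n)" by (simp add: d_def)
    then show ?thesis using cInf_lessD[of "(\<lambda>y. (norm (x - y))\<^sup>2) ` M"] ne by auto
  qed
  then obtain y where yM: "\<And>n. y n \<in> M"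
    and yd: "\<And>n. (norm (x - y n))\<^sup>2 < d + 1 / real (Suc n)" by metis
  \<comment> \<open>Parallelogram law: the midpoint \<open>?z\<close> lies in \<open>M\<close>, so
    its squared distance from \<open>x\<close> is at least \<open>d\<close>; this forces a
    minimizing sequence to be Cauchy.\<close>
  have par: "(norm (y m - y n))\<^sup>2 \<le> 2 / real (Suc m) + 2 / real (Suc n)" for m n
  proof -
    let ?z = "(1/2) *\<^sub>R (y m + y n)"
    have "?z \<in> M" using yM assms(1) by (simp add: subspace_add subspace_scale)
    note low[OF this]
    moreover have "(norm (y m - y n))\<^sup>2 = 2 * (norm (x - y m))\<^sup>2 + 2 * (norm (x - y n))\<^sup>2
        - 4 * (norm (x - ?z))\<^sup>2"
      by (simp add: power2_norm_eq_inner inner_diff inner_add inner_commute algebra_simps)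
    ultimately show ?thesis using yd[of m] yd[of n] by simp
  qed
  have "Cauchy y"
  proof (rule metric_CauchyI)
    fix e :: real assume "0 < e"
    then obtain N where N: "4 / e\<^sup>2 < real N" using reals_Archimedean2 by blast
    have "dist (y m) (y n) < e" if "m \<ge> N" "n \<ge> N" for m n
    proof -
      have "4 / e\<^sup>2 < real (Suc k)" if "k \<ge> N" for k using N that by linarith
      then have "2 / real (Suc k) < e\<^sup>2 / 2" if "k \<ge> N" for k
        using that \<open>0 < e\<close> by (simp add: field_simps del: of_nat_Suc)
      from this[OF that(1)] this[OF that(2)] have "(norm (y m - y n))\<^sup>2 < e\<^sup>2"
        using par[of m n] by linarith
      then show ?thesis using \<open>0 < e\<close> by (simp add: dist_norm power2_less_imp_less)
    qed
    then show "\<exists>N. \<forall>m\<ge>N. \<forall>n\<ge>N. dist (y m) (y n) < e" by blast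
  qed
  then obtain p where p: "y \<longlonglongrightarrow> p" using Cauchy_convergent convergent_def by blast
  have pM: "p \<in> M" using closed_sequentially[OF assms(2)] yM p by blast
  have "(\<lambda>n. (norm (x - y n))\<^sup>2) \<longlonglongrightarrow> (norm (x - p))\<^sup>2" by (intro tendsto_intros p)
  moreover have "(\<lambda>n. d + 1 / real (Suc n)) \<longlonglongrightarrow> d + 0"
    by (intro tendsto_intros LIMSEQ_Suc[OF lim_1_over_n])
  ultimately have pd: "(norm (x - p))\<^sup>2 \<le> d + 0"
    by (rule LIMSEQ_le) (use yd in \<open>auto intro: less_imp_le\<close>)
  have "(x - p) \<bullet> m = 0" if m: "m \<in> M" for m
  proof (cases "m = 0")
    case False
    \<comment> \<open>The minimizer of the squared distance along the line through \<open>p\<close>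
      in direction \<open>m\<close>. Moving there would lower it by
      \<open>((x - p) \<bullet> m)\<^sup>2 / (m \<bullet> m)\<close>, which minimality of
      \<open>p\<close> forces to be zero.\<close>
    let ?t = "((x - p) \<bullet> m) / (m \<bullet> m)"
    have expand: "(norm (a - t *\<^sub>R m))\<^sup>2 = (norm a)\<^sup>2 - 2 * t * (a \<bullet> m) + t * t * (m \<bullet> m)" for a t
      by (simp add: power2_norm_eq_inner inner_diff inner_commute algebra_simps)
    have "p + ?t *\<^sub>R m \<in> M" using pM m assms(1) by (simp add: subspace_add subspace_scale)
    from low[OF this] pd have "(norm (x - p))\<^sup>2 \<le> (norm (x - (p + ?t *\<^sub>R m)))\<^sup>2" by linarith
    also have "\<dots> = (norm (x - p))\<^sup>2 - 2 * ?t * ((x - p) \<bullet> m) + ?t * ?t * (m \<bullet> m)"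
      using expand[of "x - p" ?t] by (simp add: diff_diff_eq)
    also have "\<dots> = (norm (x - p))\<^sup>2 - ((x - p) \<bullet> m)\<^sup>2 / (m \<bullet> m)"
      using False by (simp add: field_simps power2_eq_square)
    finally have "((x - p) \<bullet> m)\<^sup>2 / (m \<bullet> m) \<le> 0" by simp
    moreover have "m \<bullet> m > 0" using False by simp
    ultimately have "((x - p) \<bullet> m)\<^sup>2 \<le> 0" by (simp add: divide_le_0_iff)
    then show ?thesis by simp
  qed simp
  then show ?thesis using pM by blast
qed

section \<open>Calculus of the orthogonal projection onto a closed subspace\<close>

context
  fixes M :: "'a::{real_inner,banach} set"
  assumes M: "subspace M" "closed M"
begin

lemma proj_in: "proj M x \<in> M" and proj_orth: "m \<in> M \<Longrightarrow> (x - proj M x) \<bullet> m = 0"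
  using someI_ex[OF projection_exists[OF M, of x, unfolded Bex_def]] unfolding proj_def by auto

lemma proj_eqI:
  assumes "p \<in> M" "\<And>m. m \<in> M \<Longrightarrow> (x - p) \<bullet> m = 0"
  shows "proj M x = p"
proof -
  have "p - proj M x \<in> M" using assms(1) proj_in M(1) by (simp add: subspace_diff)
  then have "(x - proj M x) \<bullet> (p - proj M x) = 0" "(x - p) \<bullet> (p - proj M x) = 0"
    using proj_orth assms(2) by auto
  then have "(p - proj M x) \<bullet> (p - proj M x) = 0" by (simp add: inner_diff)
  then show ?thesis by simp
qed

lemma proj_id: "x \<in> M \<Longrightarrow> proj M x = x"
  by (rule proj_eqI) auto

lemma proj_inner: "m \<in> M \<Longrightarrow> proj M x \<bullet> m = x \<bullet> m"
  using proj_orth[of m x] by (simp add: inner_diff)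

lemma norm_proj_sum: "(norm x)\<^sup>2 = (norm (proj M x))\<^sup>2 + (norm (x - proj M x))\<^sup>2"
  using proj_orth[OF proj_in, of x x]
  by (simp add: power2_norm_eq_inner inner_diff inner_commute)

lemma norm_proj_compl_le: "norm (x - proj M x) \<le> norm x"
  by (rule power2_le_imp_le) (use norm_proj_sum[of x] in auto)

lemma proj_diff: "proj M (x - y) = proj M x - proj M y"
proof (rule proj_eqI)
  show "proj M x - proj M y \<in> M" using proj_in M(1) by (simp add: subspace_diff)
  fix m assume "m \<in> M"
  then show "(x - y - (proj M x - proj M y)) \<bullet> m = 0"
    using proj_orth[of m x] proj_orth[of m y] by (simp add: inner_diff)
qed

lemma proj_add: "proj M (x + y) = proj M x + proj M y"
proof (rule proj_eqI)
  show "proj M x + proj M y \<in> M" using proj_in M(1) by (simp add: subspace_add)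
  fix m assume "m \<in> M"
  then show "(x + y - (proj M x + proj M y)) \<bullet> m = 0"
    using proj_orth[of m x] proj_orth[of m y] by (simp add: inner_diff inner_add)
qed

lemma proj_scaleR: "proj M (c *\<^sub>R x) = c *\<^sub>R proj M x"
proof (rule proj_eqI)
  show "c *\<^sub>R proj M x \<in> M" using proj_in M(1) by (simp add: subspace_scale)
  fix m assume "m \<in> M"
  then show "(c *\<^sub>R x - c *\<^sub>R proj M x) \<bullet> m = 0"
    using proj_orth[of m x] by (simp add: inner_diff)
qed

lemma linear_proj: "linear (proj M)"
  by (rule linearI) (auto simp: proj_add proj_scaleR)

end

section \<open>Closed subspaces, functionals and adjoints\<close>

lemma closed_inner_compl: "closed {x::'a::real_inner. \<forall>n\<in>N. x \<bullet> n = 0}"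
proof -
  have "{x. \<forall>n\<in>N. x \<bullet> n = 0} = (\<Inter>n\<in>N. {x. x \<bullet> n = 0})" by auto
  moreover have "closed {x. x \<bullet> n = 0}" for n :: 'a
    by (intro closed_Collect_eq continuous_intros)
  ultimately show ?thesis by auto
qed

lemma subspace_inner_compl: "subspace {x::'a::real_inner. \<forall>n\<in>N. x \<bullet> n = 0}"
  by (auto simp: subspace_def inner_add)

lemma closed_zero_set:
  assumes "bounded_linear f"
  shows "closed {x. f x = 0}"
  by (intro closed_Collect_eq linear_continuous_on[OF assms] continuous_on_const)

lemma subspace_zero_set:
  assumes "bounded_linear f"
  shows "subspace {x. f x = 0}"
  using assms by (auto simp: subspace_def linear_simps)

text \<open>The orthogonal complement of the kernel of a nonzero functional is a line. The vector
  \<open>w\<close> spans it, and evaluating at \<open>w\<close> fixes the scalar.\<close>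

lemma Riesz_representation:
  fixes f :: "'a::{real_inner,banach} \<Rightarrow> real"
  assumes "bounded_linear f"
  shows "\<exists>v. \<forall>x. f x = x \<bullet> v"
proof (cases "\<forall>x. f x = 0")
  case False
  then obtain u where u: "f u \<noteq> 0" by auto
  let ?N = "{x. f x = 0}"
  note N = subspace_zero_set[OF assms] closed_zero_set[OF assms]
  interpret f: bounded_linear f by fact
  define w where "w = u - proj ?N u"
  have fw: "f w = f u" using proj_in[OF N, of u] by (simp add: w_def f.diff)
  have ort: "w \<bullet> m = 0" if "f m = 0" for m
    using proj_orth[OF N, of m u] that by (simp add: w_def)
  have w0: "w \<noteq> 0" using fw u f.zero by force
  have "f x = x \<bullet> ((f w / (w \<bullet> w)) *\<^sub>R w)" for x
  proof -
    have "f (x - (f x / f w) *\<^sub>R w) = 0" using fw u by (simp add: f.diff f.scaleR)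
    from ort[OF this] have "x \<bullet> w = f x / f w * (w \<bullet> w)"
      by (simp add: inner_diff inner_commute)
    then show ?thesis using w0 fw u by simp
  qed
  then show ?thesis by blast
qed (auto intro: exI[of _ 0])

lemma real_adjoint_exists:
  fixes A :: "'a::{real_inner,banach} \<Rightarrow> 'b::real_inner"
  assumes "bounded_linear A"
  shows "\<exists>B. \<forall>x y. A x \<bullet> y = x \<bullet> B y"
proof -
  have "\<exists>v. \<forall>x. A x \<bullet> y = x \<bullet> v" for y
    by (rule Riesz_representation)
      (rule bounded_linear_compose[OF bounded_linear_inner_left assms])
  then show ?thesis by metis
qed

text \<open>Uniform boundedness principle through Baire: the closed sets \<open>S n\<close> cover
  the space, so one of them contains a ball, and differences of points in that ball test each
  \<open>w\<close> in its own direction.\<close>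

lemma weakly_bounded_imp_bounded:
  fixes W :: "'a::{real_inner,banach} set"
  assumes "\<And>y. \<exists>c. \<forall>w\<in>W. \<bar>y \<bullet> w\<bar> \<le> c"
  shows "\<exists>c>0. \<forall>w\<in>W. norm w \<le> c"
proof -
  define S where "S n = {y::'a. \<forall>w\<in>W. \<bar>y \<bullet> w\<bar> \<le> real n}" for n :: nat
  have clS: "closed (S n)" for n
  proof -
    have "S n = (\<Inter>w\<in>W. {y. \<bar>y \<bullet> w\<bar> \<le> real n})" by (auto simp: S_def)
    moreover have "closed {y::'a. \<bar>y \<bullet> w\<bar> \<le> real n}" for w
      by (intro closed_Collect_le continuous_intros)
    ultimately show ?thesis by auto
  qed
  have un: "(\<Union>n. S n) = UNIV"
  proof (intro equalityI subsetI UNIV_I)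
    fix y
    obtain c where c: "\<And>w. w \<in> W \<Longrightarrow> \<bar>y \<bullet> w\<bar> \<le> c" using assms by blast
    obtain n :: nat where "c \<le> real n" using real_arch_simple by blast
    then have "y \<in> S n" unfolding S_def using c by (auto intro: order_trans)
    then show "y \<in> (\<Union>n. S n)" by blast
  qed
  have "\<exists>n. interior (S n) \<noteq> {}"
  proof (rule ccontr)
    assume "\<not> (\<exists>n. interior (S n) \<noteq> {})"
    then have "Met_TC.mtopology interior_of \<Union> (range S) = {}"
      by (intro Met_TC.metric_Baire_category_alt)
        (use clS in \<open>auto simp: Met_TC.mcomplete_def Cauchy_convergent_iff convergent_def\<close>)
    then show False using un by simp
  qed
  then obtain n a where "a \<in> interior (S n)" by blast
  then obtain e where e: "e > 0" "cball a e \<subseteq> S n"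
    by (meson interior_subset mem_interior_cball)
  have "norm w \<le> 2 * real n / e" if w: "w \<in> W" for w
  proof (cases "w = 0")
    case False
    \<comment> \<open>A vector of length \<open>e\<close> in the direction of \<open>w\<close>, so
      that \<open>?u \<bullet> w = e * norm w\<close>.\<close>
    let ?u = "(e / norm w) *\<^sub>R w"
    have "a + ?u \<in> S n" "a \<in> S n" using e False by (auto intro!: subsetD[OF e(2)] simp: dist_norm)
    then have "\<bar>(a + ?u) \<bullet> w\<bar> \<le> real n" "\<bar>a \<bullet> w\<bar> \<le> real n" using w by (auto simp: S_def)
    then have "\<bar>?u \<bullet> w\<bar> \<le> 2 * real n" by (simp add: inner_add)
    then have "e * norm w \<le> 2 * real n" using e False
      by (simp add: dot_square_norm power2_eq_square abs_mult)
    then show ?thesis using e by (simp add: field_simps)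
  qed (use e in auto)
  then have "\<forall>w\<in>W. norm w \<le> 2 * real n / e + 1" by (smt (verit))
  moreover have "2 * real n / e + 1 > 0" using e by (simp add: add_nonneg_pos)
  ultimately show ?thesis by blast
qed

text \<open>Test the adjoint relation at \<open>x = B y\<close> and divide by
  \<open>norm (B y)\<close>.\<close>

lemma real_adjoint_bounded:
  fixes A :: "'a::real_inner \<Rightarrow> 'b::real_inner"
  assumes adj: "\<And>x y. A x \<bullet> y = x \<bullet> B y" and K: "\<And>x. norm (A x) \<le> K * norm x" and K0: "0 \<le> K"
  shows "norm (B y) \<le> K * norm y"
proof (cases "B y = 0")
  case False
  have "norm (B y) * norm (B y) = A (B y) \<bullet> y"
    by (simp add: adj flip: power2_eq_square power2_norm_eq_inner)
  also have "\<dots> \<le> norm (A (B y)) * norm y" by (rule norm_cauchy_schwarz)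
  also have "\<dots> \<le> K * norm (B y) * norm y" by (intro mult_right_mono K) simp
  finally have "norm (B y) * norm (B y) \<le> (K * norm y) * norm (B y)" by (simp add: ac_simps)
  then show ?thesis using False mult_right_le_imp_le by fastforce
qed (use K0 in simp)

lemma real_adjoint_linear:
  fixes A :: "'a::real_inner \<Rightarrow> 'b::real_inner"
  assumes adj: "\<And>x y. A x \<bullet> y = x \<bullet> B y"
  shows "linear B"
proof (rule linearI)
  have eqI: "u = v" if "\<And>x. x \<bullet> u = x \<bullet> v" for u v :: 'a
    using that[of "u - v"] by (metis diff_self inner_diff_right inner_eq_zero_iff right_minus_eq)
  show "B (x + y) = B x + B y" for x y
    by (rule eqI) (simp add: inner_add_right adj[symmetric])
  show "B (c *\<^sub>R x) = c *\<^sub>R B x" for c x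
    by (rule eqI) (simp add: adj[symmetric])
qed

lemma bounded_linear_real_adjoint:
  fixes A :: "'a::real_inner \<Rightarrow> 'b::real_inner"
  assumes "bounded_linear A" and adj: "\<And>x y. A x \<bullet> y = x \<bullet> B y"
  shows "bounded_linear B"
proof -
  obtain K where K: "0 < K" "\<And>x. norm (A x) \<le> norm x * K"
    using bounded_linear.pos_bounded[OF assms(1)] by blast
  interpret linear B by (rule real_adjoint_linear[OF adj])
  show ?thesis
    by (rule bounded_linear_intro[where K=K])
      (use real_adjoint_bounded[OF adj, of K] K in \<open>auto simp: add scaleR mult.commute\<close>)
qed

text \<open>Uniform boundedness takes the place of the open mapping theorem. Pairing
  \<open>y\<close> with a vector \<open>w\<close> of the range equals pairing a preimage of the
  projection of \<open>y\<close> with \<open>B w\<close>. Hence the set \<open>W\<close> is weakly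
  bounded, so the adjoint \<open>B\<close> is bounded below on the range of \<open>A\<close>;
  duality carries this bound over to \<open>A\<close> off its kernel.\<close>

lemma closed_range_bounded_below:
  fixes A :: "'a::{real_inner,banach} \<Rightarrow> 'b::{real_inner,banach}"
  assumes A: "bounded_linear A" and cl: "closed (range A)"
  shows "\<exists>c>0. \<forall>x. (\<forall>n. A n = 0 \<longrightarrow> x \<bullet> n = 0) \<longrightarrow> c * norm x \<le> norm (A x)"
proof -
  obtain B where adj: "\<And>x y. A x \<bullet> y = x \<bullet> B y" using real_adjoint_exists[OF A] by blast
  have B: "bounded_linear B" by (rule bounded_linear_real_adjoint[OF A adj])
  interpret B: bounded_linear B by fact
  have R: "subspace (range A)" by (rule linear_subspace_image[OF bounded_linear.linear[OF A] subspace_UNIV])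
  define W where "W = {w \<in> range A. norm (B w) \<le> 1}"
  have "\<exists>c>0. \<forall>w\<in>W. norm w \<le> c"
  proof (rule weakly_bounded_imp_bounded)
    fix y
    obtain z where z: "proj (range A) y = A z" using proj_in[OF R cl, of y] by auto
    have "\<bar>y \<bullet> w\<bar> \<le> norm z" if "w \<in> W" for w
    proof -
      have "y \<bullet> w = z \<bullet> B w"
        using proj_inner[OF R cl, of w y] that by (simp add: W_def z adj)
      also have "\<bar>\<dots>\<bar> \<le> norm z * norm (B w)" by (rule Cauchy_Schwarz_ineq2)
      also have "\<dots> \<le> norm z * 1" using that by (intro mult_left_mono) (auto simp: W_def)
      finally show ?thesis by simp
    qed
    then show "\<exists>c. \<forall>w\<in>W. \<bar>y \<bullet> w\<bar> \<le> c" by blast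
  qed
  then obtain c where c: "c > 0" "\<And>w. w \<in> W \<Longrightarrow> norm w \<le> c" by blast
  have low: "norm w \<le> c * norm (B w)" if w: "w \<in> range A" for w
  proof (cases "B w = 0")
    case True
    obtain z where "w = A z" using w by auto
    then have "w \<bullet> w = 0" using True adj[of z w] by simp
    then show ?thesis by simp
  next
    case False
    have "(1 / norm (B w)) *\<^sub>R w \<in> W"
      using w R False by (simp add: W_def subspace_scale B.scaleR)
    from c(2)[OF this] show ?thesis using False by (simp add: field_simps)
  qed
  have "complete (B ` range A)"
    by (rule complete_isometric_image[OF _ R B, of "1 / c"])
      (use c low cl in \<open>auto simp: field_simps complete_eq_closed\<close>)
  then have clB: "closed (B ` range A)" by (simp add: complete_eq_closed)
  have sB: "subspace (B ` range A)" by (rule linear_subspace_image[OF B.linear R])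
  have "(1 / c) * norm x \<le> norm (A x)" if x: "\<forall>n. A n = 0 \<longrightarrow> x \<bullet> n = 0" for x
  proof -
    \<comment> \<open>The part of \<open>x\<close> outside the closed image of \<open>B\<close>. It
      lies in the kernel of \<open>A\<close>, to which both \<open>x\<close> and that image are
      orthogonal, so it vanishes and \<open>x = B w\<close> with \<open>w\<close> in the range of
      \<open>A\<close>.\<close>
    define r where "r = x - proj (B ` range A) x"
    have "r \<bullet> B (A r) = 0" unfolding r_def by (intro proj_orth[OF sB clB]) auto
    then have "A r \<bullet> A r = 0" by (simp add: adj)
    then have Ar: "A r = 0" by simp
    obtain w where w: "w \<in> range A" "proj (B ` range A) x = B w"
      using proj_in[OF sB clB, of x] by blast
    have "B w \<bullet> r = 0" using adj[of r w] Ar by (simp add: inner_commute)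
    moreover have "x \<bullet> r = 0" using x Ar by blast
    ultimately have "r \<bullet> r = 0" using w by (simp add: r_def inner_diff_left)
    then have xw: "x = B w" using w by (simp add: r_def)
    have "norm x * norm x = A x \<bullet> w"
      using adj[of x w] xw by (simp flip: power2_eq_square power2_norm_eq_inner)
    also have "\<dots> \<le> norm (A x) * norm w" by (rule norm_cauchy_schwarz)
    also have "\<dots> \<le> norm (A x) * (c * norm x)"
      using low[OF w(1)] xw by (intro mult_left_mono) auto
    finally have "norm x * norm x \<le> (c * norm (A x)) * norm x" by (simp add: ac_simps)
    then have "norm x \<le> c * norm (A x)"
      using c(1) mult_right_le_imp_le[of "norm x" "norm x" "c * norm (A x)"] by (cases "x = 0") auto
    then show ?thesis using c(1) by (simp add: field_simps)
  qed
  then show ?thesis using c(1) by (intro exI[of _ "1/c"]) auto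
qed

section \<open>Gaps between subspaces of equal finite dimension\<close>

text \<open>Explicit finite bases make finiteness of the common real dimension part of the
  condition.\<close>

definition equidimensional :: "'a::real_vector set \<Rightarrow> 'a set \<Rightarrow> bool" where
  "equidimensional G1 G2 \<longleftrightarrow> (\<exists>B1 B2. finite B1 \<and> finite B2 \<and> card B1 = card B2 \<and>
     independent B1 \<and> independent B2 \<and> G1 = span B1 \<and> G2 = span B2)"

lemma equidimensional_sym: "equidimensional G1 G2 \<Longrightarrow> equidimensional G2 G1"
  unfolding equidimensional_def by metis

text \<open>The image of a basis is independent and already has as many elements as
  \<open>B2\<close>. A vector of \<open>B2\<close> outside its span would enlarge it to an
  independent set in \<open>span B2\<close> with more elements than \<open>B2\<close>.\<close>

lemma equidimensional_injective_imp_surjective: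
  assumes "equidimensional G1 G2" and f: "linear f" "f ` G1 \<subseteq> G2" "\<And>x. x \<in> G1 \<Longrightarrow> f x = 0 \<Longrightarrow> x = 0"
  shows "f ` G1 = G2"
proof -
  obtain B1 B2 where B: "finite B1" "finite B2" "card B1 = card B2" "independent B1"
    "G1 = span B1" "G2 = span B2"
    using assms(1) unfolding equidimensional_def by metis
  interpret linear f by fact
  have inj: "inj_on f (span B1)"
  proof (rule inj_onI)
    fix x y assume "x \<in> span B1" "y \<in> span B1" "f x = f y"
    then show "x = y" using f(3)[of "x - y"] B by (simp add: diff span_diff)
  qed
  have ind: "independent (f ` B1)" by (rule linear_independent_injective_image[OF f(1) B(4) inj])
  have sub: "f ` B1 \<subseteq> span B2" using f(2) B(5,6) span_superset[of B1] by auto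
  have card: "card (f ` B1) = card B2"
    using B(3) card_image[OF inj_on_subset[OF inj span_superset]] by simp
  have "G2 \<subseteq> span (f ` B1)"
  proof -
    have "b \<in> span (f ` B1)" if b: "b \<in> B2" for b
    proof (rule ccontr)
      assume nb: "b \<notin> span (f ` B1)"
      then have "independent (insert b (f ` B1))" using ind by (simp add: independent_insert)
      moreover have "insert b (f ` B1) \<subseteq> span B2" using sub b span_superset[of B2] by auto
      ultimately have "card (insert b (f ` B1)) \<le> card B2"
        using independent_span_bound[OF B(2)] by simp
      moreover have "b \<notin> f ` B1" using nb span_base by metis
      ultimately show False using B(1) card by simp
    qed
    then show ?thesis unfolding B(6) by (intro span_minimal subspace_span subsetI)
  qed
  then show ?thesis using f(2) B(5,6) linear_span_image[OF f(1), of B1] by simp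
qed

text \<open>
  This is where finiteness is indispensable: for a subspace and a proper closed subspace of it of
  the same infinite dimension the two gaps differ.
\<close>

lemma equidimensional_gap_symmetric:
  fixes G1 G2 :: "'a::{real_inner,banach} set"
  assumes dim: "equidimensional G1 G2"
    and G1: "subspace G1" "closed G1" and G2: "subspace G2" "closed G2"
    and c0: "0 \<le> c"
    and c: "\<And>x. x \<in> G2 \<Longrightarrow> norm (x - proj G1 x) \<le> c * norm x"
    and y: "y \<in> G1"
  shows "norm (y - proj G2 y) \<le> c * norm y"
proof (cases "c < 1")
  \<comment> \<open>For \<open>c \<ge> 1\<close> the bound is just contractivity of the
    complementary projection.\<close>
  case False
  have "norm (y - proj G2 y) \<le> 1 * norm y" using norm_proj_compl_le[OF G2, of y] by simp
  also have "\<dots> \<le> c * norm y" using False by (intro mult_right_mono) auto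
  finally show ?thesis .
next
  case True
  \<comment> \<open>For \<open>c < 1\<close> no nonzero vector of \<open>G2\<close> projects to
    zero, so equality of the finite dimensions makes every \<open>y\<close> in \<open>G1\<close> the
    projection of some \<open>x\<close> in \<open>G2\<close>.\<close>
  have "proj G1 ` G2 = G1"
  proof (rule equidimensional_injective_imp_surjective[OF equidimensional_sym[OF dim] linear_proj[OF G1]])
    show "proj G1 ` G2 \<subseteq> G1" using proj_in[OF G1] by auto
    fix x assume "x \<in> G2" "proj G1 x = 0"
    then have "norm x \<le> c * norm x" using c[of x] by simp
    then show "x = 0" using True by (simp add: mult_le_cancel_right1 not_le)
  qed
  then obtain x where x: "x \<in> G2" "y = proj G1 x" using y by auto
  show ?thesis
  proof (cases "y = 0")
    case True
    then show ?thesis using proj_id[OF G2] subspace_0[OF G2(1)] by simp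
  next
    case False
    have "(norm (x - y))\<^sup>2 \<le> (c * norm x)\<^sup>2" using c[OF x(1)] x by (auto intro: power_mono)
    then have xy: "(1 - c\<^sup>2) * (norm x)\<^sup>2 \<le> (norm y)\<^sup>2"
      using norm_proj_sum[OF G1, of x] x by (simp add: algebra_simps power_mult_distrib)
    \<comment> \<open>Moving both projections across the inner product bounds
      \<open>(norm y)\<^sup>2\<close> by \<open>norm x * norm (proj G2 y)\<close>. Eliminating
      \<open>norm x\<close> with \<open>xy\<close> leaves a lower bound for
      \<open>proj G2 y\<close>, and Pythagoras turns it into the claim.\<close>
    have "(norm y)\<^sup>2 = x \<bullet> y"
      using proj_inner[OF G1 y, of x] x by (simp add: power2_norm_eq_inner)
    also have "\<dots> = x \<bullet> proj G2 y" using proj_inner[OF G2 x(1), of y] by (simp add: inner_commute)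
    also have "\<dots> \<le> norm x * norm (proj G2 y)" by (rule norm_cauchy_schwarz)
    finally have "((norm y)\<^sup>2)\<^sup>2 \<le> (norm x * norm (proj G2 y))\<^sup>2" by (rule power_mono) simp
    then have "(norm y)\<^sup>2 * (norm y)\<^sup>2 \<le> (norm x)\<^sup>2 * (norm (proj G2 y))\<^sup>2"
      by (simp add: power2_eq_square[of "(norm y)\<^sup>2"] power_mult_distrib)
    moreover have "(1 - c\<^sup>2) * ((norm x)\<^sup>2 * (norm (proj G2 y))\<^sup>2) \<le> (norm y)\<^sup>2 * (norm (proj G2 y))\<^sup>2"
      using mult_right_mono[OF xy, of "(norm (proj G2 y))\<^sup>2"] by (simp add: mult.assoc)
    moreover have "0 \<le> 1 - c\<^sup>2" using \<open>c < 1\<close> c0 by (simp add: power_le_one)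
    ultimately have "(1 - c\<^sup>2) * ((norm y)\<^sup>2 * (norm y)\<^sup>2) \<le> (norm y)\<^sup>2 * (norm (proj G2 y))\<^sup>2"
      using mult_left_mono order_trans by meson
    then have "(norm y)\<^sup>2 * ((1 - c\<^sup>2) * (norm y)\<^sup>2) \<le> (norm y)\<^sup>2 * (norm (proj G2 y))\<^sup>2"
      by (metis mult.left_commute)
    then have "(1 - c\<^sup>2) * (norm y)\<^sup>2 \<le> (norm (proj G2 y))\<^sup>2" using False by simp
    then have "(norm (y - proj G2 y))\<^sup>2 \<le> (c * norm y)\<^sup>2"
      using norm_proj_sum[OF G2, of y] by (simp add: algebra_simps power_mult_distrib)
    then show ?thesis using c0 by (meson mult_nonneg_nonneg norm_ge_zero power2_le_imp_le)
  qed
qed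

lemma proj_compl:
  fixes R :: "'a::{real_inner,banach} set"
  assumes R: "subspace R" "closed R"
  shows "proj {x. \<forall>r\<in>R. x \<bullet> r = 0} y = y - proj R y"
proof (rule proj_eqI[OF subspace_inner_compl closed_inner_compl])
  show "y - proj R y \<in> {x. \<forall>r\<in>R. x \<bullet> r = 0}" using proj_orth[OF R] by simp
  show "(y - (y - proj R y)) \<bullet> m = 0" if "m \<in> {x. \<forall>r\<in>R. x \<bullet> r = 0}" for m
    using that proj_in[OF R, of y] by (simp add: inner_commute[of _ m])
qed

text \<open>With \<open>P1\<close>, \<open>P2\<close> the projections onto \<open>R1\<close>,
  \<open>R2\<close>, the operators \<open>(1 - P2) P1\<close> and \<open>P1 (1 - P2)\<close> are
  adjoint and have equal norm. So a gap between ranges is a gap between complements in reverse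
  order; this is used before and after the finite-dimensional symmetry.\<close>

lemma equidimensional_compl_gap_symmetric:
  fixes R1 R2 :: "'a::{real_inner,banach} set"
  assumes dim: "equidimensional {x. \<forall>r\<in>R1. x \<bullet> r = 0} {x. \<forall>r\<in>R2. x \<bullet> r = 0}"
    and R1: "subspace R1" "closed R1" and R2: "subspace R2" "closed R2"
    and c0: "0 \<le> c"
    and c: "\<And>x. x \<in> R1 \<Longrightarrow> norm (x - proj R2 x) \<le> c * norm x"
    and r: "r \<in> R2"
  shows "norm (r - proj R1 r) \<le> c * norm r"
proof -
  let ?G1 = "{x. \<forall>r\<in>R1. x \<bullet> r = 0}" and ?G2 = "{x. \<forall>r\<in>R2. x \<bullet> r = 0}"
  have 1: "norm (x - proj ?G1 x) \<le> c * norm x" if x: "x \<in> ?G2" for x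
  proof -
    let ?p = "proj R1 x"
    have p: "?p \<in> R1" by (rule proj_in[OF R1])
    have "norm ?p * norm ?p = ?p \<bullet> x"
      using proj_inner[OF R1 p, of x]
      by (simp add: inner_commute flip: power2_eq_square power2_norm_eq_inner)
    also have "\<dots> = (?p - proj R2 ?p) \<bullet> x"
      using x proj_in[OF R2, of ?p] by (simp add: inner_diff_left inner_commute[of "proj R2 ?p"])
    also have "\<dots> \<le> norm (?p - proj R2 ?p) * norm x" by (rule norm_cauchy_schwarz)
    also have "\<dots> \<le> c * norm ?p * norm x" by (intro mult_right_mono c p) simp
    finally have *: "norm ?p * norm ?p \<le> (c * norm x) * norm ?p" by (simp add: ac_simps)
    have "norm ?p \<le> c * norm x"
      by (cases "?p = 0") (use c0 mult_right_le_imp_le[OF *] in auto)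
    then show ?thesis by (simp add: proj_compl[OF R1])
  qed
  let ?e = "r - proj R1 r"
  have e: "?e \<in> ?G1" using proj_orth[OF R1] by simp
  have 2: "norm (proj R2 ?e) \<le> c * norm ?e"
    using equidimensional_gap_symmetric[OF dim subspace_inner_compl closed_inner_compl
        subspace_inner_compl closed_inner_compl c0 1 e]
    by (simp add: proj_compl[OF R2])
  have "norm ?e * norm ?e = ?e \<bullet> ?e" by (simp flip: power2_eq_square power2_norm_eq_inner)
  also have "\<dots> = ?e \<bullet> r"
    using proj_orth[OF R1 proj_in[OF R1], of r r] inner_diff_right[of ?e r "proj R1 r"] by linarith
  also have "\<dots> = proj R2 ?e \<bullet> r" using proj_inner[OF R2 r] by simp
  also have "\<dots> \<le> norm (proj R2 ?e) * norm r" by (rule norm_cauchy_schwarz)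
  also have "\<dots> \<le> c * norm ?e * norm r" using 2 by (intro mult_right_mono) auto
  finally have *: "norm ?e * norm ?e \<le> (c * norm r) * norm ?e" by (simp add: ac_simps)
  show ?thesis
    by (cases "?e = 0") (use c0 mult_right_le_imp_le[OF *] in auto)
qed

section \<open>Perturbation of polar factors\<close>

text \<open>A first-order form of the semigroup argument for Sylvester equations. Replacing
  \<open>x\<close>, \<open>y\<close> by \<open>x - t H1 x\<close>, \<open>y - t H2 y\<close> shrinks
  the product of the norms by the factor \<open>1 - t (s1 + s2)\<close> up to order
  \<open>t\<^sup>2\<close>, while \<open>f\<close> changes by \<open>t\<close> times the Sylvester
  form, again up to order \<open>t\<^sup>2\<close>. Comparing with the norm \<open>K\<close> of
  \<open>f\<close> on the two subspaces and letting \<open>t\<close> tend to 0 gives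
  \<open>K (s1 + s2) \<le> C\<close>.\<close>

lemma sylvester_bound:
  fixes f :: "'a::real_inner \<Rightarrow> 'b::real_inner \<Rightarrow> real"
  assumes f: "bounded_bilinear f"
    and H1: "bounded_linear H1" and H2: "bounded_linear H2"
    and M: "subspace M" "subspace N"
    and inv1: "\<And>x. x \<in> M \<Longrightarrow> H1 x \<in> M" and inv2: "\<And>y. y \<in> N \<Longrightarrow> H2 y \<in> N"
    and low1: "\<And>x. x \<in> M \<Longrightarrow> s1 * (norm x)\<^sup>2 \<le> H1 x \<bullet> x"
    and low2: "\<And>y. y \<in> N \<Longrightarrow> s2 * (norm y)\<^sup>2 \<le> H2 y \<bullet> y"
    and C: "\<And>x y. x \<in> M \<Longrightarrow> y \<in> N \<Longrightarrow> \<bar>f (H1 x) y + f x (H2 y)\<bar> \<le> C * norm x * norm y"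
    and s: "0 < s1 + s2"
    and xy: "x \<in> M" "y \<in> N"
  shows "\<bar>f x y\<bar> \<le> C / (s1 + s2) * norm x * norm y"
proof (cases "x = 0 \<or> y = 0")
  case True
  then show ?thesis using bounded_bilinear.zero_left[OF f] bounded_bilinear.zero_right[OF f] by auto
next
  case False
  interpret f: bounded_bilinear f by fact
  interpret H1: bounded_linear H1 by fact
  interpret H2: bounded_linear H2 by fact
  define S where "S = {\<bar>f x y\<bar> | x y. x \<in> M \<and> y \<in> N \<and> norm x = 1 \<and> norm y = 1}"
  define K where "K = Sup S"
  have normalize: "\<bar>f x y\<bar> = \<bar>f (x /\<^sub>R norm x) (y /\<^sub>R norm y)\<bar> * norm x * norm y"
    if "x \<noteq> 0" "y \<noteq> 0" for x y
    using that by (simp add: f.scaleR_left f.scaleR_right abs_mult field_simps)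
  have unitS: "\<bar>f (x /\<^sub>R norm x) (y /\<^sub>R norm y)\<bar> \<in> S"
    if "x \<noteq> 0" "y \<noteq> 0" "x \<in> M" "y \<in> N" for x y
    unfolding S_def using that M by (auto simp: subspace_scale intro!: exI)
  obtain B where B: "\<And>x y. norm (f x y) \<le> norm x * norm y * B" using f.bounded by blast
  have "bdd_above S"
  proof (rule bdd_aboveI)
    fix k assume "k \<in> S"
    then obtain x y where "k = \<bar>f x y\<bar>" "norm x = 1" "norm y = 1" by (auto simp: S_def)
    then show "k \<le> B" using B[of x y] by simp
  qed
  then have SK: "k \<le> K" if "k \<in> S" for k unfolding K_def using that by (rule cSup_upper[rotated])
  have neS: "S \<noteq> {}" using unitS[of x y] False xy by auto
  have K0: "0 \<le> K" using SK[OF unitS[of x y]] False xy by (smt (verit))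
  have fK: "\<bar>f x y\<bar> \<le> K * norm x * norm y" if "x \<in> M" "y \<in> N" for x y
  proof (cases "x = 0 \<or> y = 0")
    case False
    then have "\<bar>f x y\<bar> = \<bar>f (x /\<^sub>R norm x) (y /\<^sub>R norm y)\<bar> * norm x * norm y"
      using normalize by blast
    also have "\<dots> \<le> K * norm x * norm y"
      using False that by (intro mult_right_mono SK unitS) auto
    finally show ?thesis .
  qed (auto simp: f.zero_left f.zero_right)
  obtain h1 where h1: "\<And>x. norm (H1 x) \<le> norm x * h1" using H1.bounded by blast
  obtain h2 where h2: "\<And>x. norm (H2 x) \<le> norm x * h2" using H2.bounded by blast
  define h where "h = max (max h1 h2) 0"
  have hh: "norm (H1 x) \<le> h * norm x" "norm (H2 y) \<le> h * norm y" and h0: "0 \<le> h" for x y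
    using order_trans[OF h1[of x] mult_left_mono[of h1 h "norm x"]]
      order_trans[OF h2[of y] mult_left_mono[of h2 h "norm y"]]
    by (auto simp: h_def mult.commute)
  have key: "K * (s1 + s2) \<le> C + t * (2 * K * h\<^sup>2)" if t: "0 < t" for t
  proof -
    have "k \<le> K * (1 - t * (s1 + s2) + t\<^sup>2 * h\<^sup>2) + t * C + t\<^sup>2 * K * h\<^sup>2" if kS: "k \<in> S" for k
    proof -
      obtain x y where k: "k = \<bar>f x y\<bar>" and x: "x \<in> M" "norm x = 1" and y: "y \<in> N" "norm y = 1"
        using kS by (auto simp: S_def)
      define u v where "u = x - t *\<^sub>R H1 x" and "v = y - t *\<^sub>R H2 y"
      have uv: "u \<in> M" "v \<in> N"
        using x y M inv1 inv2 by (simp_all add: u_def v_def subspace_diff subspace_scale)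
      have sq: "(norm (a - t *\<^sub>R b))\<^sup>2 = (norm a)\<^sup>2 - 2 * t * (b \<bullet> a) + t\<^sup>2 * (norm b)\<^sup>2"
        for a b :: "'c::real_inner"
        unfolding power2_norm_eq_inner
        by (simp add: inner_diff inner_commute algebra_simps power2_eq_square[of t])
      have "(norm (H1 x))\<^sup>2 \<le> h\<^sup>2" "(norm (H2 y))\<^sup>2 \<le> h\<^sup>2"
        using hh(1)[of x] hh(2)[of y] x y h0 by (simp_all add: power_mono)
      then have "t\<^sup>2 * (norm (H1 x))\<^sup>2 \<le> t\<^sup>2 * h\<^sup>2" "t\<^sup>2 * (norm (H2 y))\<^sup>2 \<le> t\<^sup>2 * h\<^sup>2"
        by (simp_all add: mult_left_mono)
      moreover have "t * s1 \<le> t * (H1 x \<bullet> x)" "t * s2 \<le> t * (H2 y \<bullet> y)"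
        using low1[OF x(1)] low2[OF y(1)] x y t by simp_all
      ultimately have uv2: "(norm u)\<^sup>2 + (norm v)\<^sup>2 \<le> 2 * (1 - t * (s1 + s2) + t\<^sup>2 * h\<^sup>2)"
        unfolding u_def v_def sq using x y by (simp add: algebra_simps)
      \<comment> \<open>The arithmetic-geometric mean inequality passes from the sum of squares to
        the product, where \<open>s1\<close> and \<open>s2\<close> enter only through their
        sum.\<close>
      have "norm u * norm v \<le> 1 - t * (s1 + s2) + t\<^sup>2 * h\<^sup>2"
        using order_trans[OF sum_squares_bound uv2] by (simp only: mult.assoc mult_le_cancel_left_pos zero_less_numeral)
      then have fuv: "\<bar>f u v\<bar> \<le> K * (1 - t * (s1 + s2) + t\<^sup>2 * h\<^sup>2)"
        using fK[OF uv] mult_left_mono[OF _ K0] by (fastforce simp: mult.assoc)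
      have "\<bar>f (H1 x) (H2 y)\<bar> \<le> K * norm (H1 x) * norm (H2 y)" using fK x y inv1 inv2 by blast
      also have "\<dots> \<le> K * h * h"
        using hh(1)[of x] hh(2)[of y] x y h0 K0 by (intro mult_mono) auto
      finally have "t\<^sup>2 * \<bar>f (H1 x) (H2 y)\<bar> \<le> t\<^sup>2 * (K * h\<^sup>2)"
        by (simp add: power2_eq_square[of h] mult.assoc mult_left_mono)
      then have "\<bar>t\<^sup>2 * f (H1 x) (H2 y)\<bar> \<le> t\<^sup>2 * (K * h\<^sup>2)" by (simp add: abs_mult)
      moreover have "\<bar>t * (f (H1 x) y + f x (H2 y))\<bar> \<le> t * C"
        using C[OF x(1) y(1)] x y t by (simp add: abs_mult)
      moreover have "f x y = f u v + t * (f (H1 x) y + f x (H2 y)) - t\<^sup>2 * f (H1 x) (H2 y)"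
        by (simp add: u_def v_def f.diff_left f.diff_right f.scaleR_left f.scaleR_right
            algebra_simps power2_eq_square)
      ultimately show ?thesis using fuv k by (simp add: mult.assoc)
    qed
    then have "K \<le> K * (1 - t * (s1 + s2) + t\<^sup>2 * h\<^sup>2) + t * C + t\<^sup>2 * K * h\<^sup>2"
      unfolding K_def using neS by (intro cSup_least)
    then have "t * (K * (s1 + s2)) \<le> t * (C + t * (2 * K * h\<^sup>2))"
      by (simp add: algebra_simps power2_eq_square)
    then show ?thesis using t by simp
  qed
  \<comment> \<open>Letting \<open>t\<close> tend to 0 from above removes the second-order
    error.\<close>
  have "((\<lambda>t. C + t * (2 * K * h\<^sup>2)) \<longlongrightarrow> C + 0 * (2 * K * h\<^sup>2)) (at_right 0)"
    by (intro tendsto_intros)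
  then have "K * (s1 + s2) \<le> C + 0 * (2 * K * h\<^sup>2)"
    by (rule tendsto_lowerbound)
      (use key in \<open>auto simp: eventually_at_right_less eventually_at_filter\<close>)
  then have "K \<le> C / (s1 + s2)" using s by (simp add: field_simps)
  then have "K * norm x * norm y \<le> C / (s1 + s2) * norm x * norm y"
    by (intro mult_right_mono) auto
  then show ?thesis using fK[OF xy] by linarith
qed

text \<open>The real-linear content of a polar decomposition, with \<open>H\<close> standing for the
  modulus. All estimates run on these properties, so complex scalars matter only when they are
  verified. Here \<sigma> may be any positive lower bound of \<open>H\<close> on the complement of
  the kernel.\<close>

locale closed_range_polar =
  fixes A Q :: "'a::{real_inner,banach} \<Rightarrow> 'b::{real_inner,banach}" and H :: "'a \<Rightarrow> 'a" and \<sigma> :: real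
  assumes bounded_linear_A: "bounded_linear A"
    and bounded_linear_Q: "bounded_linear Q"
    and bounded_linear_H: "bounded_linear H"
    and closed_range: "closed (range A)"
    and factorization: "A x = Q (H x)"
    and kernel_Q: "Q x = 0 \<longleftrightarrow> A x = 0"
    and norm_H: "norm (H x) = norm (A x)"
    and symmetric: "H x \<bullet> y = x \<bullet> H y"
    and isometric: "(\<And>n. A n = 0 \<Longrightarrow> x \<bullet> n = 0) \<Longrightarrow> norm (Q x) = norm x"
    and gap: "(\<And>n. A n = 0 \<Longrightarrow> x \<bullet> n = 0) \<Longrightarrow> \<sigma> * (norm x)\<^sup>2 \<le> H x \<bullet> x"
    and gap_pos: "0 < \<sigma>"
begin

section \<open>Geometry of a single polar decomposition\<close>

interpretation A: bounded_linear A by (rule bounded_linear_A)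
interpretation Q: bounded_linear Q by (rule bounded_linear_Q)
interpretation H: bounded_linear H by (rule bounded_linear_H)

definition N where "N = {x. A x = 0}"
definition M where "M = {x. \<forall>n\<in>N. x \<bullet> n = 0}"

lemma subspace_N: "subspace N" and closed_N: "closed N"
  unfolding N_def using bounded_linear_A by (auto intro: subspace_zero_set closed_zero_set)

lemma subspace_M: "subspace M" and closed_M: "closed M"
  unfolding M_def by (rule subspace_inner_compl closed_inner_compl)+

lemma subspace_range: "subspace (range A)"
  by (rule linear_subspace_image[OF A.linear subspace_UNIV])

lemma isometric_M: "x \<in> M \<Longrightarrow> norm (Q x) = norm x"
  by (rule isometric) (auto simp: M_def N_def)

lemma gap_M: "x \<in> M \<Longrightarrow> \<sigma> * (norm x)\<^sup>2 \<le> H x \<bullet> x"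
  by (rule gap) (auto simp: M_def N_def)

lemma H_in_M: "H x \<in> M"
proof -
  have "H n = 0" if "A n = 0" for n using norm_H[of n] that by simp
  then show ?thesis by (simp add: M_def N_def symmetric)
qed

lemma compl_in_M: "x - proj N x \<in> M"
  unfolding M_def by (auto intro: proj_orth subspace_N closed_N)

lemma A_compl: "A (x - proj N x) = A x" and Q_compl: "Q (x - proj N x) = Q x"
proof -
  have "A (proj N x) = 0" using proj_in[OF subspace_N closed_N] by (auto simp: N_def)
  moreover from this have "Q (proj N x) = 0" by (simp add: kernel_Q)
  ultimately show "A (x - proj N x) = A x" "Q (x - proj N x) = Q x"
    by (simp_all add: A.diff Q.diff)
qed

lemma norm_Q: "norm (Q x) = norm (x - proj N x)"
  using isometric_M[OF compl_in_M, of x] by (simp add: Q_compl)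

text \<open>Polarization of the isometry on \<open>M\<close>.\<close>

lemma inner_Q:
  assumes "x \<in> M" "y \<in> M"
  shows "Q x \<bullet> Q y = x \<bullet> y"
proof -
  have "norm (Q (x + y)) = norm (x + y)" using assms subspace_M by (simp add: isometric_M subspace_add)
  then have "(norm (Q x + Q y))\<^sup>2 = (norm (x + y))\<^sup>2" by (simp add: Q.add)
  then have "Q x \<bullet> Q x + Q y \<bullet> Q y + 2 * (Q x \<bullet> Q y) = x \<bullet> x + y \<bullet> y + 2 * (x \<bullet> y)"
    unfolding power2_norm_eq_inner by (simp add: inner_add inner_commute)
  moreover have "Q x \<bullet> Q x = x \<bullet> x" "Q y \<bullet> Q y = y \<bullet> y"
    using assms[THEN isometric_M] by (simp_all add: norm_eq)
  ultimately show ?thesis by linarith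
qed

lemma H_lower:
  assumes "x \<in> M"
  shows "\<sigma> * norm x \<le> norm (H x)"
proof (cases "x = 0")
  case False
  have "\<sigma> * norm x * norm x \<le> norm (H x) * norm x"
    using gap_M[OF assms] norm_cauchy_schwarz[of "H x" x] by (simp add: power2_eq_square)
  then show ?thesis using False by simp
qed simp

lemma A_lower: "\<sigma> * norm (Q x) \<le> norm (A x)"
  using H_lower[OF compl_in_M, of x] by (simp add: norm_H A_compl norm_Q)

text \<open>The lower bound makes the image of \<open>M\<close> closed. A remainder \<open>r\<close>
  orthogonal to it satisfies \<open>r \<bullet> H r = 0\<close>, which the gap allows only for
  \<open>r = 0\<close>. The consequence needed later is that \<open>Q\<close> maps into the range of
  \<open>A\<close>.\<close>

lemma H_surj:
  assumes "x \<in> M"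
  obtains z where "z \<in> M" "x = H z"
proof -
  have "complete (H ` M)"
    by (rule complete_isometric_image[OF gap_pos subspace_M bounded_linear_H])
      (use H_lower closed_M in \<open>auto simp: complete_eq_closed\<close>)
  then have cl: "closed (H ` M)" by (simp add: complete_eq_closed)
  have sub: "subspace (H ` M)" by (rule linear_subspace_image[OF H.linear subspace_M])
  let ?r = "x - proj (H ` M) x"
  have "proj (H ` M) x \<in> H ` M" by (rule proj_in[OF sub cl])
  then have r: "?r \<in> M" using H_in_M assms by (auto intro!: subspace_diff subspace_M)
  have "?r \<bullet> H ?r = 0" using r by (intro proj_orth[OF sub cl]) auto
  then have "\<sigma> * (norm ?r)\<^sup>2 \<le> 0" using gap_M[OF r] by (simp add: inner_commute)
  then have "?r = 0" using gap_pos by (simp add: mult_le_0_iff)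
  then show thesis using that \<open>proj (H ` M) x \<in> H ` M\<close> by auto
qed

lemma Q_in_range: "Q x \<in> range A"
proof -
  obtain z where "x - proj N x = H z" using H_surj[OF compl_in_M] by metis
  then have "Q x = A z" using Q_compl[of x] by (simp add: factorization)
  then show ?thesis by simp
qed

lemma range_eq: "range A = Q ` M"
  using Q_in_range H_in_M by (auto simp: factorization)

end

section \<open>Blocks of the difference of two polar factors\<close>

lemma polar_sylvester:
  assumes "closed_range_polar A1 Q1 H1 s1" "closed_range_polar A2 Q2 H2 s2"
    and D: "\<And>x. norm (A1 x - A2 x) \<le> D * norm x"
    and x: "x \<in> closed_range_polar.M A1"
  shows "norm (proj (range A2) (Q1 x - Q2 x)) \<le> 2 * D / (s1 + s2) * norm x"
proof -
  interpret one: closed_range_polar A1 Q1 H1 s1 by fact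
  interpret two: closed_range_polar A2 Q2 H2 s2 by fact
  interpret Q1: bounded_linear Q1 by (rule one.bounded_linear_Q)
  interpret Q2: bounded_linear Q2 by (rule two.bounded_linear_Q)
  \<comment> \<open>For \<open>y\<close> in \<open>two.M\<close> this is the bilinear form of
    \<open>Q2* Q1 - 1\<close>, because \<open>Q2* Q2\<close> is the projection onto
    \<open>two.M\<close>.\<close>
  define f where "f x y = (Q1 x - Q2 x) \<bullet> Q2 y" for x y
  have "bounded_bilinear f"
    unfolding f_def
    by (intro bounded_bilinear.comp[OF bounded_bilinear_inner] bounded_linear_intros
      bounded_linear_sub one.bounded_linear_Q two.bounded_linear_Q)
  have C: "\<bar>f (H1 x) y + f x (H2 y)\<bar> \<le> 2 * D * norm x * norm y"
    if x: "x \<in> one.M" and y: "y \<in> two.M" for x y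
  proof -
    have 1: "Q2 z \<bullet> Q2 w = z \<bullet> w" if w: "w \<in> two.M" for z w
    proof -
      have "Q2 z \<bullet> Q2 w = (z - proj two.N z) \<bullet> w"
        using two.inner_Q[OF two.compl_in_M w] by (simp add: two.Q_compl)
      then show ?thesis using w proj_in[OF two.subspace_N two.closed_N, of z]
        by (simp add: inner_diff two.M_def inner_commute[of _ w])
    qed
    have 2: "Q1 x \<bullet> A1 y = x \<bullet> H1 y"
      using one.inner_Q[OF x one.H_in_M] by (simp add: one.factorization)
    have 3: "A2 x \<bullet> Q2 y = x \<bullet> H2 y"
      using 1[OF y] by (simp add: two.factorization two.symmetric)
    \<comment> \<open>Symmetry of \<open>H1\<close> and \<open>H2\<close> turns the terms without a
      polar factor into ones that regroup as two pairings with \<open>A1 - A2\<close>, each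
      contributing one \<open>D\<close>.\<close>
    have "f (H1 x) y + f x (H2 y) = A1 x \<bullet> Q2 y - x \<bullet> H1 y + Q1 x \<bullet> A2 y - x \<bullet> H2 y"
      using 1[OF y] 1[OF two.H_in_M]
      by (simp add: f_def inner_diff one.symmetric flip: one.factorization two.factorization)
    also have "\<dots> = (A1 x - A2 x) \<bullet> Q2 y - Q1 x \<bullet> (A1 y - A2 y)"
      using 2 3 by (simp add: inner_diff)
    finally have "\<bar>f (H1 x) y + f x (H2 y)\<bar> \<le> \<bar>(A1 x - A2 x) \<bullet> Q2 y\<bar> + \<bar>Q1 x \<bullet> (A1 y - A2 y)\<bar>"
      by linarith
    also have "\<dots> \<le> norm (A1 x - A2 x) * norm (Q2 y) + norm (Q1 x) * norm (A1 y - A2 y)"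
      by (intro add_mono Cauchy_Schwarz_ineq2)
    also have "\<dots> \<le> D * norm x * norm y + norm x * (D * norm y)"
      using x y D by (intro add_mono mult_mono) (auto simp: one.isometric_M two.isometric_M intro: order_trans[OF norm_ge_zero D])
    finally show ?thesis by (simp add: algebra_simps)
  qed
  have fle: "\<bar>f x y\<bar> \<le> 2 * D / (s1 + s2) * norm x * norm y" if "y \<in> two.M" for y
    by (rule sylvester_bound[OF \<open>bounded_bilinear f\<close> one.bounded_linear_H two.bounded_linear_H
          one.subspace_M two.subspace_M _ _ one.gap_M two.gap_M C _ x that])
      (auto simp: one.H_in_M two.H_in_M one.gap_pos two.gap_pos add_pos_pos)
  note R = two.subspace_range two.closed_range
  let ?w = "proj (range A2) (Q1 x - Q2 x)"
  \<comment> \<open>The projected vector lies in the range of \<open>A2\<close>, which is the image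
    of \<open>two.M\<close> under \<open>Q2\<close>; it can therefore be tested against itself
    through \<open>f\<close>.\<close>
  obtain y where y: "y \<in> two.M" "?w = Q2 y"
    using proj_in[OF R, of "Q1 x - Q2 x"] two.range_eq by auto
  have "norm ?w * norm ?w = (Q1 x - Q2 x) \<bullet> ?w"
    using proj_inner[OF R proj_in[OF R], of "Q1 x - Q2 x" "Q1 x - Q2 x"]
    by (simp flip: power2_eq_square power2_norm_eq_inner)
  also have "\<dots> = f x y" by (simp add: f_def y(2))
  also have "\<dots> \<le> 2 * D / (s1 + s2) * norm x * norm ?w"
    using fle[OF y(1)] y by (simp add: two.isometric_M)
  finally have *: "norm ?w * norm ?w \<le> 2 * D / (s1 + s2) * norm x * norm ?w" .
  show ?thesis
  proof (cases "?w = 0")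
    case True
    then show ?thesis using order_trans[OF norm_ge_zero D, of x] one.gap_pos two.gap_pos by simp
  next
    case False
    then show ?thesis using mult_right_le_imp_le[OF *] by simp
  qed
qed

text \<open>Write \<open>r = A1 z\<close> with \<open>z\<close> orthogonal to the kernel, so
  \<open>norm z \<le> norm r / s1\<close>. Since \<open>A2 z\<close> lies in the range of
  \<open>A2\<close>, only \<open>(A1 - A2) z\<close> survives the complementary projection.\<close>

lemma polar_range_gap:
  assumes "closed_range_polar A1 Q1 H1 s1" "closed_range_polar A2 Q2 H2 s2"
    and D: "\<And>x. norm (A1 x - A2 x) \<le> D * norm x"
    and r: "r \<in> range A1"
  shows "norm (r - proj (range A2) r) \<le> D / s1 * norm r"
proof -
  interpret one: closed_range_polar A1 Q1 H1 s1 by fact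
  interpret two: closed_range_polar A2 Q2 H2 s2 by fact
  note R = two.subspace_range two.closed_range
  obtain z where z: "z \<in> one.M" "r = A1 z"
    using r one.A_compl one.compl_in_M by (metis imageE)
  have "A1 z - proj (range A2) (A1 z) = (A1 z - A2 z) - proj (range A2) (A1 z - A2 z)"
    using proj_id[OF R, of "A2 z"] by (simp add: proj_diff[OF R])
  then have "norm (r - proj (range A2) r) \<le> norm (A1 z - A2 z)"
    using norm_proj_compl_le[OF R, of "A1 z - A2 z"] z by metis
  also have "\<dots> \<le> D * norm z" by (rule D)
  also have "\<dots> \<le> D * (norm r / s1)"
    using one.H_lower[OF z(1)] one.gap_pos z order_trans[OF norm_ge_zero D, of z]
    linear_0[OF bounded_linear.linear[OF one.bounded_linear_A]]
    by (cases "z = 0") (auto simp: one.norm_H field_simps zero_le_mult_iff intro!: mult_left_mono)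
  finally show ?thesis by simp
qed

text \<open>On the kernel of \<open>A2\<close> the operator \<open>A1\<close> coincides with
  \<open>A1 - A2\<close>, and it dominates \<open>s1\<close> times its polar factor.\<close>

lemma polar_kernel_gap:
  assumes "closed_range_polar A1 Q1 H1 s1"
    and D: "\<And>x. norm (A1 x - A2 x) \<le> D * norm x"
    and n: "A2 n = 0"
  shows "norm (Q1 n) \<le> D / s1 * norm n"
proof -
  interpret one: closed_range_polar A1 Q1 H1 s1 by fact
  have "s1 * norm (Q1 n) \<le> D * norm n" using one.A_lower[of n] D[of n] n by simp
  then show ?thesis using one.gap_pos by (simp add: field_simps)
qed

text \<open>The two off-diagonal pieces act on orthogonal components of \<open>x\<close> and have
  orthogonal ranges, so by Pythagoras they cost a single \<open>k\<close>. The triangle inequality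
  with the diagonal piece adds the second one.\<close>

lemma polar_block_bound:
  assumes "closed_range_polar A1 Q1 H1 s1" "closed_range_polar A2 Q2 H2 s2"
    and k: "0 \<le> k"
    and diag: "\<And>x. x \<in> closed_range_polar.M A1 \<Longrightarrow> norm (proj (range A2) (Q1 x - Q2 x)) \<le> k * norm x"
    and ran: "\<And>r. r \<in> range A1 \<Longrightarrow> norm (r - proj (range A2) r) \<le> k * norm r"
    and ker: "\<And>n. A1 n = 0 \<Longrightarrow> norm (Q2 n) \<le> k * norm n"
  shows "norm (Q1 x - Q2 x) \<le> 2 * k * norm x"
proof -
  interpret one: closed_range_polar A1 Q1 H1 s1 by fact
  interpret two: closed_range_polar A2 Q2 H2 s2 by fact
  interpret Q1: bounded_linear Q1 by (rule one.bounded_linear_Q)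
  interpret Q2: bounded_linear Q2 by (rule two.bounded_linear_Q)
  note R = two.subspace_range two.closed_range
  note N = one.subspace_N one.closed_N
  let ?n = "proj one.N x" and ?P = "proj (range A2)"
  let ?p = "x - ?n"
  have p: "?p \<in> one.M" by (rule one.compl_in_M)
  have n: "A1 ?n = 0" using proj_in[OF N, of x] by (simp add: one.N_def)
  have x2: "(norm x)\<^sup>2 = (norm ?n)\<^sup>2 + (norm ?p)\<^sup>2" by (rule norm_proj_sum[OF N])
  define u where "u = Q1 ?p - ?P (Q1 ?p)"
  have PQ2: "?P (Q2 z) = Q2 z" for z by (rule proj_id[OF R two.Q_in_range])
  have "Q1 x = Q1 ?p" by (simp only: one.Q_compl)
  moreover have "Q2 x = Q2 ?p + Q2 ?n" by (simp flip: Q2.add)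
  ultimately have split: "Q1 x - Q2 x = ?P (Q1 ?p - Q2 ?p) + (u - Q2 ?n)"
    by (simp add: proj_diff[OF R] PQ2 u_def)
  have "u \<bullet> Q2 ?n = 0" unfolding u_def by (rule proj_orth[OF R two.Q_in_range])
  then have "(norm (u - Q2 ?n))\<^sup>2 = (norm u)\<^sup>2 + (norm (Q2 ?n))\<^sup>2"
    unfolding power2_norm_eq_inner by (simp add: inner_diff inner_commute)
  moreover have "norm u \<le> k * norm ?p"
    using ran[OF one.Q_in_range, of ?p] one.isometric_M[OF p] by (simp add: u_def)
  moreover have "norm (Q2 ?n) \<le> k * norm ?n" by (rule ker[OF n])
  ultimately have "(norm (u - Q2 ?n))\<^sup>2 \<le> (k * norm ?p)\<^sup>2 + (k * norm ?n)\<^sup>2"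
    by (simp add: add_mono power_mono)
  also have "\<dots> = (k * norm x)\<^sup>2" by (simp add: power_mult_distrib x2 algebra_simps)
  finally have off: "norm (u - Q2 ?n) \<le> k * norm x"
    using k by (meson mult_nonneg_nonneg norm_ge_zero power2_le_imp_le)
  have "norm (?P (Q1 ?p - Q2 ?p)) \<le> k * norm ?p" by (rule diag[OF p])
  also have "\<dots> \<le> k * norm x" by (intro mult_left_mono norm_proj_compl_le[OF N] k)
  finally have "norm (Q1 x - Q2 x) \<le> k * norm x + k * norm x"
    unfolding split using off norm_triangle_mono by blast
  then show ?thesis by simp
qed

lemma polar_perturbation_aux:
  assumes crp1: "closed_range_polar A1 Q1 H1 s1" and crp2: "closed_range_polar A2 Q2 H2 s2"
    and D: "\<And>x. norm (A1 x - A2 x) \<le> D * norm x" and D0: "0 \<le> D"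
    and s: "s2 \<le> s1"
    and dim: "equidimensional {x. A1 x = 0} {x. A2 x = 0} \<or>
      equidimensional {x. \<forall>r\<in>range A1. x \<bullet> r = 0} {x. \<forall>r\<in>range A2. x \<bullet> r = 0}"
  shows "norm (Q1 x - Q2 x) \<le> 4 * D / (s1 + s2) * norm x"
proof -
  interpret one: closed_range_polar A1 Q1 H1 s1 by fact
  interpret two: closed_range_polar A2 Q2 H2 s2 by fact
  define k where "k = 2 * D / (s1 + s2)"
  have k0: "0 \<le> k" using D0 one.gap_pos two.gap_pos by (simp add: k_def)
  \<comment> \<open>Here \<open>s2 \<le> s1\<close> enters: both gap bounds divide by the larger
    spectral gap, hence stay below the Sylvester constant \<open>k\<close>.\<close>
  have "D / s1 \<le> k"
  proof -
    have "D / s1 = 2 * D / (s1 + s1)" using one.gap_pos by simp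
    also have "\<dots> \<le> k" unfolding k_def
      using D0 s one.gap_pos two.gap_pos by (intro divide_left_mono mult_pos_pos) auto
    finally show ?thesis .
  qed
  then have k: "D / s1 * norm x \<le> k * norm x" for x :: "'c::real_normed_vector"
    by (intro mult_right_mono) auto
  have D': "norm (A2 x - A1 x) \<le> D * norm x" for x using D[of x] by (simp add: norm_minus_commute)
  have ran: "norm (r - proj (range A2) r) \<le> k * norm r" if "r \<in> range A1" for r
    using order_trans[OF polar_range_gap[OF crp1 crp2 D that] k] .
  have ker: "norm (Q1 n) \<le> k * norm n" if "A2 n = 0" for n
    using order_trans[OF polar_kernel_gap[OF crp1 D that] k] .
  from dim have "norm (Q1 x - Q2 x) \<le> 2 * k * norm x"
  proof
    assume dim: "equidimensional {x. A1 x = 0} {x. A2 x = 0}"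
    show ?thesis
    proof (rule polar_block_bound[OF crp1 crp2 k0 _ ran])
      show "norm (proj (range A2) (Q1 x - Q2 x)) \<le> k * norm x" if "x \<in> one.M" for x
        unfolding k_def using polar_sylvester[OF crp1 crp2 D that] .
      \<comment> \<open>By \<open>norm_Q\<close> the norm of \<open>Q n\<close> is the distance from
        \<open>n\<close> to the kernel, so this is the gap between the kernels with roles
        reversed.\<close>
      show "norm (Q2 n) \<le> k * norm n" if "A1 n = 0" for n
        using equidimensional_gap_symmetric[OF dim[folded one.N_def two.N_def] one.subspace_N
            one.closed_N two.subspace_N two.closed_N k0, of n] ker that
        by (simp add: one.norm_Q two.norm_Q one.N_def two.N_def)
    qed
  next
    assume dim: "equidimensional {x. \<forall>r\<in>range A1. x \<bullet> r = 0} {x. \<forall>r\<in>range A2. x \<bullet> r = 0}"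
    \<comment> \<open>After exchanging the operators, the required kernel bound is
      \<open>ker\<close> itself, and it is the range gap that must be reversed.\<close>
    have "norm (Q2 x - Q1 x) \<le> 2 * k * norm x"
    proof (rule polar_block_bound[OF crp2 crp1 k0 _ _ ker])
      show "norm (proj (range A1) (Q2 x - Q1 x)) \<le> k * norm x" if "x \<in> two.M" for x
        using polar_sylvester[OF crp2 crp1 D' that] by (simp add: k_def add.commute)
      show "norm (r - proj (range A1) r) \<le> k * norm r" if "r \<in> range A2" for r
        by (rule equidimensional_compl_gap_symmetric[OF dim one.subspace_range one.closed_range
            two.subspace_range two.closed_range k0 ran that])
    qed
    then show ?thesis by (simp add: norm_minus_commute)
  qed
  then show ?thesis by (simp add: k_def)
qed

lemma polar_perturbation:
  assumes crp1: "closed_range_polar A1 Q1 H1 s1" and crp2: "closed_range_polar A2 Q2 H2 s2"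
    and D: "\<And>x. norm (A1 x - A2 x) \<le> D * norm x" and D0: "0 \<le> D"
    and dim: "equidimensional {x. A1 x = 0} {x. A2 x = 0} \<or>
      equidimensional {x. \<forall>r\<in>range A1. x \<bullet> r = 0} {x. \<forall>r\<in>range A2. x \<bullet> r = 0}"
  shows "norm (Q1 x - Q2 x) \<le> 4 * D / (s1 + s2) * norm x"
proof (cases "s2 \<le> s1")
  case True
  then show ?thesis using polar_perturbation_aux[OF crp1 crp2 D D0 _ dim] by blast
next
  case False
  have "norm (Q2 x - Q1 x) \<le> 4 * D / (s2 + s1) * norm x"
    by (rule polar_perturbation_aux[OF crp2 crp1 _ D0])
      (use False D dim in \<open>auto simp: norm_minus_commute dest: equidimensional_sym\<close>)
  then show ?thesis by (simp add: norm_minus_commute add.commute)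
qed

section \<open>Complex structure and the operator modulus\<close>

instance chilbert_space \<subseteq> banach ..

section \<open>Complex scalars and the real inner product\<close>

lemma bounded_linear_clinear: "bounded_clinear A \<Longrightarrow> bounded_linear A"
  and clinear_scaleC: "bounded_clinear A \<Longrightarrow> A (c *\<^sub>C x) = c *\<^sub>C A x"
  by (auto simp: bounded_clinear_def)

lemma cinner_scaleC_right: "cinner x (c *\<^sub>C y) = cnj c * cinner x y"
  by (metis cinner_commute cinner_scaleC_left complex_cnj_mult)

text \<open>Recovers the complex inner product from the real one, so a real identity for maps
  commuting with the imaginary unit becomes a complex one.\<close>

lemma cinner_eq_Complex: "cinner x y = Complex (x \<bullet> y) (- ((\<i> *\<^sub>C x) \<bullet> y))"
  by (rule complex_eqI) (simp_all add: Re_cinner[symmetric] cinner_scaleC_left)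

lemma inner_ii_left:
  fixes x y :: "'a::complex_inner"
  shows "(\<i> *\<^sub>C x) \<bullet> y = - (x \<bullet> (\<i> *\<^sub>C y))"
  by (simp add: Re_cinner[symmetric] cinner_scaleC_left cinner_scaleC_right)

lemma norm_scaleC:
  fixes x :: "'a::complex_inner"
  shows "norm (c *\<^sub>C x) = cmod c * norm x"
proof -
  have "cinner (c *\<^sub>C x) (c *\<^sub>C x) = c * cnj c * cinner x x"
    by (simp add: cinner_scaleC_left cinner_scaleC_right)
  then have "complex_of_real ((norm (c *\<^sub>C x))\<^sup>2) = complex_of_real ((cmod c * norm x)\<^sup>2)"
    by (simp only: cinner_self power_mult_distrib of_real_mult complex_norm_square[of c, symmetric])
  then have "(norm (c *\<^sub>C x))\<^sup>2 = (cmod c * norm x)\<^sup>2" by (simp only: of_real_eq_iff)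
  then show ?thesis by (simp add: power2_eq_iff_nonneg)
qed

lemma scaleC_scaleR: "c *\<^sub>C (r *\<^sub>R x) = r *\<^sub>R (c *\<^sub>C x)"
  by (simp add: scaleC_of_real[symmetric] scaleC_scaleC mult.commute)

lemma scaleC_complex_split: "c *\<^sub>C x = Re c *\<^sub>R x + Im c *\<^sub>R (\<i> *\<^sub>C x)"
proof -
  have "c *\<^sub>C x = (complex_of_real (Re c) + complex_of_real (Im c) * \<i>) *\<^sub>C x"
    by (metis complex_eq mult.commute)
  then show ?thesis
    unfolding scaleC_add_left scaleC_of_real[symmetric] scaleC_scaleC .
qed

lemma scaleC_minus_left: "(- c) *\<^sub>C x = - (c *\<^sub>C x)"
  by (simp add: scaleC_complex_split[of c] scaleC_complex_split[of "-c"])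

lemma scaleC_one: "1 *\<^sub>C x = x"
  using scaleC_of_real[of 1 x] by simp

lemma bounded_linear_scaleC: "bounded_linear ((*\<^sub>C) c :: 'a::complex_inner \<Rightarrow> 'a)"
  by (rule bounded_linear_intro[where K="cmod c"])
    (auto simp: scaleC_add_right scaleC_scaleR norm_scaleC mult.commute)

lemma scaleC_diff_right: "c *\<^sub>C (x - y) = c *\<^sub>C x - c *\<^sub>C (y::'a::complex_inner)"
  by (rule linear_simps(2)[OF bounded_linear_scaleC])

lemma scaleC_zero: "c *\<^sub>C 0 = (0::'a::complex_inner)"
  by (rule linear_simps(3)[OF bounded_linear_scaleC])

section \<open>Complex subspaces and their orthogonal complements\<close>

definition csubspace :: "'a::complex_inner set \<Rightarrow> bool" where
  "csubspace S \<longleftrightarrow> subspace S \<and> (\<forall>c. \<forall>x\<in>S. c *\<^sub>C x \<in> S)"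

text \<open>In a complex subspace the imaginary part of the inner product with \<open>x\<close> is,
  up to sign, a real part with \<open>\<i> *\<^sub>C x\<close>, so real orthogonality implies
  complex orthogonality.\<close>

lemma ortho_compl_eq:
  assumes "csubspace S"
  shows "ortho_compl S = {y. \<forall>x\<in>S. y \<bullet> x = 0}"
proof -
  have "cinner x y = 0" if "\<forall>x\<in>S. y \<bullet> x = 0" "x \<in> S" for x y
    using that assms by (auto simp: cinner_eq_Complex csubspace_def inner_commute complex_eq_iff)
  moreover have "y \<bullet> x = 0" if "cinner x y = 0" for x y :: 'a
    using that by (metis Re_cinner inner_commute zero_complex.simps(1))
  ultimately show ?thesis by (auto simp: ortho_compl_def)
qed

lemma csubspace_kernel: "bounded_clinear A \<Longrightarrow> csubspace (kernel A)"
  unfolding csubspace_def kernel_def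
  using subspace_zero_set[OF bounded_linear_clinear, of A]
  by (auto simp: clinear_scaleC scaleC_zero)

lemma csubspace_range: "bounded_clinear A \<Longrightarrow> csubspace (range A)"
  unfolding csubspace_def
  using linear_subspace_image[OF bounded_linear.linear[OF bounded_linear_clinear, of A] subspace_UNIV]
  by (auto simp: clinear_scaleC[symmetric])

lemma csubspace_ortho_compl:
  assumes "csubspace S"
  shows "csubspace (ortho_compl S)"
proof -
  have "c *\<^sub>C y \<in> ortho_compl S" if "y \<in> ortho_compl S" for c y
    using that by (simp add: ortho_compl_def cinner_scaleC_right)
  moreover have "subspace (ortho_compl S)"
    unfolding ortho_compl_eq[OF assms] by (rule subspace_inner_compl)
  ultimately show ?thesis by (simp add: csubspace_def)
qed

section \<open>Adjoints of complex operators\<close>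

lemma cadjoint:
  fixes A :: "'a::chilbert_space \<Rightarrow> 'b::chilbert_space"
  assumes "bounded_clinear A"
  shows "cinner (A x) y = cinner x (cadjoint A y)"
proof -
  obtain B where adj: "\<And>x y. A x \<bullet> y = x \<bullet> B y"
    using real_adjoint_exists[OF bounded_linear_clinear[OF assms]] by blast
  have "\<exists>B. \<forall>x y. cinner (A x) y = cinner x (B y)"
    by (rule exI[of _ B]) (simp add: cinner_eq_Complex adj clinear_scaleC[OF assms, symmetric])
  from someI_ex[OF this] show ?thesis unfolding cadjoint_def by blast
qed

lemma cadjoint_inner:
  fixes A :: "'a::chilbert_space \<Rightarrow> 'b::chilbert_space"
  assumes "bounded_clinear A"
  shows "A x \<bullet> y = x \<bullet> cadjoint A y"
  using cadjoint[OF assms, of x y] by (metis Re_cinner)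

lemma bounded_clinear_cadjoint:
  fixes A :: "'a::chilbert_space \<Rightarrow> 'b::chilbert_space"
  assumes A: "bounded_clinear A"
  shows "bounded_clinear (cadjoint A)"
  unfolding bounded_clinear_def
proof (intro conjI allI)
  show "bounded_linear (cadjoint A)"
    by (rule bounded_linear_real_adjoint[OF bounded_linear_clinear[OF A] cadjoint_inner[OF A]])
  fix c y
  define d where "d = cadjoint A (c *\<^sub>C y) - c *\<^sub>C cadjoint A y"
  have "cinner x (cadjoint A (c *\<^sub>C y)) = cinner x (c *\<^sub>C cadjoint A y)" for x
    by (simp add: cadjoint[OF A, symmetric] cinner_scaleC_right)
  then have "x \<bullet> cadjoint A (c *\<^sub>C y) = x \<bullet> (c *\<^sub>C cadjoint A y)" for x
    by (metis Re_cinner)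
  then have "x \<bullet> d = 0" for x
    by (simp add: d_def inner_diff_right)
  then have "d = 0" using inner_eq_zero_iff by blast
  then show "cadjoint A (c *\<^sub>C y) = c *\<^sub>C cadjoint A y" by (simp add: d_def)
qed

section \<open>Square roots of positive operators\<close>

text \<open>
  The iteration \<open>Y \<mapsto> (B + Y\<^sup>2) / 2\<close> started at \<open>0\<close> is dominated by the same iteration for the
  number \<open>1\<close>, which increases to at most \<open>1\<close>.  Its limit \<open>Y\<close> satisfies \<open>(1 - Y)\<^sup>2 = 1 - B\<close>.
\<close>

lemma sqrt_iteration:
  fixes B :: "'a::banach \<Rightarrow>\<^sub>L 'a"
  assumes B: "norm B \<le> 1"
    and S: "closed S" "0 \<in> S" "\<And>Y. Y \<in> S \<Longrightarrow> (1/2) *\<^sub>R (B + (Y o\<^sub>L Y)) \<in> S"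
  shows "\<exists>Y\<in>S. norm Y \<le> 1 \<and> Y = (1/2) *\<^sub>R (B + (Y o\<^sub>L Y))"
proof -
  define F where "F Y = (1/2) *\<^sub>R (B + (Y o\<^sub>L Y))" for Y
  define G where "G (t::real) = (1 + t * t) / 2" for t
  define Y where "Y n = (F ^^ n) 0" for n
  define y where "y n = (G ^^ n) 0" for n
  \<comment> \<open>The difference of squares for factors that need not commute.\<close>
  have F_diff: "F U - F V = (1/2) *\<^sub>R ((U o\<^sub>L (U - V)) + ((U - V) o\<^sub>L V))" for U V
    unfolding F_def scaleR_diff_right[symmetric]
    by (simp add: bounded_bilinear.diff_left[OF bounded_bilinear_blinfun_compose]
        bounded_bilinear.diff_right[OF bounded_bilinear_blinfun_compose])
  have Y0: "Y 0 = 0" and YS: "Y (Suc n) = F (Y n)" for n by (simp_all add: Y_def)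
  have y0: "y 0 = 0" and yS: "y (Suc n) = G (y n)" for n by (simp_all add: y_def)
  have y01: "0 \<le> y n \<and> y n \<le> 1" for n
  proof (induction n)
    case (Suc n)
    then have "y n * y n \<le> 1" by (simp add: mult_le_one)
    then show ?case by (simp add: yS G_def)
  qed (simp add: y0)
  \<comment> \<open>The closed set \<open>S\<close> is invariant under the iteration, so the limit
    inherits the properties that define it.\<close>
  have YSS: "Y n \<in> S" for n
    by (induction n) (auto simp: Y0 YS F_def S)
  have Yy: "norm (Y n) \<le> y n" for n
  proof (induction n)
    case (Suc n)
    have "norm (F (Y n)) \<le> (norm B + norm (Y n o\<^sub>L Y n)) / 2"
      using norm_triangle_ineq[of B "Y n o\<^sub>L Y n"] by (simp add: F_def)
    also have "\<dots> \<le> (1 + y n * y n) / 2"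
      using B order_trans[OF norm_blinfun_compose mult_mono[OF Suc Suc]] y01[of n]
      by (simp add: add_mono)
    finally show ?case by (simp add: YS yS G_def)
  qed (simp add: Y0 y0)
  have step: "norm (Y (Suc n) - Y n) \<le> y (Suc n) - y n" for n
  proof (induction n)
    case 0
    show ?case using B by (simp add: Y0 y0 YS yS F_def G_def)
  next
    case (Suc n)
    let ?D = "Y (Suc n) - Y n"
    have "Y (Suc (Suc n)) - Y (Suc n) = (1/2) *\<^sub>R ((Y (Suc n) o\<^sub>L ?D) + (?D o\<^sub>L Y n))"
      using F_diff[of "Y (Suc n)" "Y n"] by (simp only: YS)
    then have "norm (Y (Suc (Suc n)) - Y (Suc n))
        \<le> (norm (Y (Suc n) o\<^sub>L ?D) + norm (?D o\<^sub>L Y n)) / 2"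
      using norm_triangle_ineq[of "Y (Suc n) o\<^sub>L ?D" "?D o\<^sub>L Y n"] by simp
    also have "\<dots> \<le> (y (Suc n) * (y (Suc n) - y n) + (y (Suc n) - y n) * y n) / 2"
      using order_trans[OF norm_blinfun_compose mult_mono[OF Yy[of "Suc n"] Suc]]
        order_trans[OF norm_blinfun_compose mult_mono[OF Suc Yy[of n]]]
        y01[of n] y01[of "Suc n"] order_trans[OF norm_ge_zero Suc]
      by (simp add: add_mono)
    also have "\<dots> = y (Suc (Suc n)) - y (Suc n)"
      unfolding yS[of "Suc n"] using yS[of n] by (simp add: G_def field_simps)
    finally show ?case .
  qed
  have mono: "y n \<le> y (Suc n)" for n using step[of n] norm_ge_zero order_trans by (metis diff_ge_0_iff_ge)
  \<comment> \<open>Summed increments are dominated by those of the scalar sequence, whose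
    convergence makes \<open>Y\<close> Cauchy.\<close>
  have tele: "norm (Y (n + k) - Y n) \<le> y (n + k) - y n" for n k
  proof (induction k)
    case (Suc k)
    have "norm (Y (n + Suc k) - Y n) \<le> norm (Y (Suc (n + k)) - Y (n + k)) + norm (Y (n + k) - Y n)"
      using norm_triangle_ineq[of "Y (Suc (n + k)) - Y (n + k)" "Y (n + k) - Y n"] by simp
    then show ?case using Suc step[of "n + k"] by simp
  qed simp
  have "convergent y"
    by (rule Bseq_mono_convergent[OF BseqI'[of y 1]]) (use y01 mono in \<open>auto intro: lift_Suc_mono_le\<close>)
  then have "Cauchy y" by (rule convergent_Cauchy)
  have "Cauchy Y"
  proof (rule metric_CauchyI)
    fix e :: real assume "0 < e"
    then obtain N where N: "\<And>m n. m \<ge> N \<Longrightarrow> n \<ge> N \<Longrightarrow> dist (y m) (y n) < e"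
      using metric_CauchyD[OF \<open>Cauchy y\<close>] by blast
    have "dist (Y m) (Y n) < e" if "m \<ge> n" "n \<ge> N" for m n
      using tele[of n "m - n"] N[of m n] that by (simp add: dist_norm dist_real_def)
    then show "\<exists>N. \<forall>m\<ge>N. \<forall>n\<ge>N. dist (Y m) (Y n) < e"
      by (metis dist_commute nle_le)
  qed
  then obtain L where L: "Y \<longlonglongrightarrow> L" using Cauchy_convergent convergent_def by blast
  have "L \<in> S" using closed_sequentially[OF S(1) YSS L] .
  moreover have "norm L \<le> 1"
    by (rule Lim_bounded[OF tendsto_norm[OF L]]) (use Yy y01 order_trans in blast)
  moreover have "L = F L"
  proof (rule LIMSEQ_unique)
    show "(\<lambda>n. Y (Suc n)) \<longlonglongrightarrow> L" by (rule LIMSEQ_Suc[OF L])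
    show "(\<lambda>n. Y (Suc n)) \<longlonglongrightarrow> F L" unfolding YS F_def
      by (intro tendsto_intros bounded_bilinear.tendsto[OF bounded_bilinear_blinfun_compose] L)
  qed
  ultimately show ?thesis unfolding F_def by blast
qed

lemma positive_operator_inner_nonneg:
  assumes "positive_operator H"
  shows "0 \<le> H x \<bullet> x"
  using assms Re_cinner[of "H x" x] unfolding positive_operator_def
  by (metis complex_nonneg_Reals_iff)

text \<open>A real quadratic form forces symmetry over the complex numbers: polarizing the vanishing
  imaginary part gives an antisymmetric form, and inserting \<open>(- \<i>) *\<^sub>C x\<close>
  turns it into symmetry of \<open>H\<close>.\<close>

lemma positive_operator_symmetric:
  fixes H :: "'a::complex_inner \<Rightarrow> 'a"
  assumes H: "positive_operator H"
  shows "H x \<bullet> y = x \<bullet> H y"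
proof -
  have cl: "bounded_clinear H" using H by (simp add: positive_operator_def)
  interpret H: bounded_linear H by (rule bounded_linear_clinear[OF cl])
  have im: "(\<i> *\<^sub>C H z) \<bullet> z = 0" for z
  proof -
    have "cinner (H z) z \<in> \<real>\<^sub>\<ge>\<^sub>0" using H by (simp add: positive_operator_def)
    then have "Im (cinner (H z) z) = 0" by (simp add: complex_nonneg_Reals_iff)
    then show ?thesis by (simp add: cinner_eq_Complex)
  qed
  have alt: "(\<i> *\<^sub>C H u) \<bullet> v = - ((\<i> *\<^sub>C H v) \<bullet> u)" for u v
    using im[of "u + v"] im[of u] im[of v]
    by (simp add: H.add scaleC_add_right inner_add)
  have ii: "\<i> *\<^sub>C (- \<i>) *\<^sub>C z = z" for z :: 'a by (simp add: scaleC_scaleC scaleC_one)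
  have "H x \<bullet> y = (\<i> *\<^sub>C H ((- \<i>) *\<^sub>C x)) \<bullet> y" by (simp only: clinear_scaleC[OF cl] ii)
  also have "\<dots> = H y \<bullet> (\<i> *\<^sub>C (- \<i>) *\<^sub>C x)" by (simp only: alt[of _ y] inner_ii_left[of "H y"] minus_minus)
  finally show ?thesis by (simp only: ii inner_commute)
qed

text \<open>Scaling \<open>T = A* A\<close> by the square of a bound \<open>K\<close> of
  \<open>A\<close> makes \<open>B = 1 - T / K\<^sup>2\<close> a contraction. A fixed point
  \<open>Y\<close> of the iteration then satisfies \<open>(1 - Y)\<^sup>2 = T / K\<^sup>2\<close>,
  and \<open>P = K (1 - Y)\<close> is the root.\<close>

lemma operator_sqrt_exists:
  fixes A :: "'a::chilbert_space \<Rightarrow> 'b::chilbert_space"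
  assumes A: "bounded_clinear A"
  shows "\<exists>P. positive_operator P \<and> P \<circ> P = cadjoint A \<circ> A"
proof -
  interpret A: bounded_linear A by (rule bounded_linear_clinear[OF A])
  interpret A': bounded_linear "cadjoint A"
    by (rule bounded_linear_clinear[OF bounded_clinear_cadjoint[OF A]])
  obtain K where K: "0 < K" "\<And>x. norm (A x) \<le> K * norm x"
    using A.pos_bounded by (metis mult.commute)
  define T where "T x = cadjoint A (A x)" for x
  have T: "bounded_linear T"
    unfolding T_def by (rule bounded_linear_compose[OF A'.bounded_linear_axioms A.bounded_linear_axioms])
  have Tsym: "T x \<bullet> y = x \<bullet> T y" for x y
    by (metis T_def cadjoint_inner[OF A] inner_commute)
  have Tc: "T (c *\<^sub>C x) = c *\<^sub>C T x" for c x
    by (simp add: T_def clinear_scaleC[OF A] clinear_scaleC[OF bounded_clinear_cadjoint[OF A]])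
  define B where "B = id_blinfun - (1 / K\<^sup>2) *\<^sub>R Blinfun T"
  have B: "blinfun_apply B x = x - (1 / K\<^sup>2) *\<^sub>R T x" for x
    by (simp add: B_def blinfun.bilinear_simps bounded_linear_Blinfun_apply[OF T])
  have "norm B \<le> 1"
  proof (rule norm_blinfun_bound)
    fix x
    let ?k = "1 / K\<^sup>2"
    have "norm (T x) \<le> K * norm (A x)"
      unfolding T_def using real_adjoint_bounded[OF cadjoint_inner[OF A] K(2)] K(1) by simp
    then have "(norm (T x))\<^sup>2 \<le> K\<^sup>2 * (norm (A x))\<^sup>2"
      by (metis norm_ge_zero power_mono power_mult_distrib)
    then have "?k * ?k * (norm (T x))\<^sup>2 \<le> ?k * ?k * (K\<^sup>2 * (norm (A x))\<^sup>2)"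
      by (intro mult_left_mono) auto
    also have "\<dots> = ?k * (norm (A x))\<^sup>2" using K(1) by (simp add: field_simps power4_eq_xxxx power2_eq_square)
    finally have k: "?k * ?k * (norm (T x))\<^sup>2 \<le> ?k * (norm (A x))\<^sup>2" .
    have "x \<bullet> T x = (norm (A x))\<^sup>2" by (simp add: T_def cadjoint_inner[OF A, symmetric] power2_norm_eq_inner)
    moreover have "(norm (x - k *\<^sub>R T x))\<^sup>2 = (norm x)\<^sup>2 - 2 * (k * (x \<bullet> T x)) + k * k * (norm (T x))\<^sup>2" for k
      by (simp add: power2_norm_eq_inner inner_diff inner_commute algebra_simps)
    ultimately have "(norm (x - ?k *\<^sub>R T x))\<^sup>2 = (norm x)\<^sup>2 - 2 * (?k * (norm (A x))\<^sup>2) + ?k * ?k * (norm (T x))\<^sup>2"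
      by (simp only:)
    moreover have "0 \<le> ?k * (norm (A x))\<^sup>2" by simp
    ultimately have "(norm (x - ?k *\<^sub>R T x))\<^sup>2 \<le> (norm x)\<^sup>2" using k by linarith
    then have "norm (x - ?k *\<^sub>R T x) \<le> norm x" by (rule power2_le_imp_le) simp
    then show "norm (blinfun_apply B x) \<le> 1 * norm x" by (simp add: B)
  qed simp
  \<comment> \<open>Symmetry and complex linearity are closed conditions preserved by the iteration;
    they pass to \<open>Y\<close> and so to \<open>P\<close>.\<close>
  define S where "S = {Z::'a \<Rightarrow>\<^sub>L 'a. (\<forall>x y. blinfun_apply Z x \<bullet> y = x \<bullet> blinfun_apply Z y) \<and>
      (\<forall>c x. blinfun_apply Z (c *\<^sub>C x) = c *\<^sub>C blinfun_apply Z x)}"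
  have cont: "continuous_on UNIV (\<lambda>Z::'a \<Rightarrow>\<^sub>L 'a. c *\<^sub>C blinfun_apply Z x)" for c x
    using bounded_linear.continuous_on[OF bounded_linear_scaleC, of UNIV "\<lambda>Z::'a \<Rightarrow>\<^sub>L 'a. blinfun_apply Z x"]
    by (simp add: continuous_intros)
  have "closed S"
    unfolding S_def
    by (intro closed_Collect_conj closed_Collect_all closed_Collect_eq continuous_intros cont)
  moreover have "0 \<in> S"
    by (simp add: S_def scaleC_zero)
  moreover have "(1/2) *\<^sub>R (B + (Z o\<^sub>L Z)) \<in> S" if "Z \<in> S" for Z
    using that unfolding S_def
    by (simp add: blinfun.bilinear_simps B inner_add inner_diff Tsym Tc scaleC_add_right
        scaleC_diff_right scaleC_scaleR)
  ultimately obtain Y where Y: "Y \<in> S" "norm Y \<le> 1" "Y = (1/2) *\<^sub>R (B + (Y o\<^sub>L Y))"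
    using sqrt_iteration[OF \<open>norm B \<le> 1\<close>, of S] by blast
  have Yeq: "blinfun_apply Y (blinfun_apply Y x) = 2 *\<^sub>R blinfun_apply Y x - blinfun_apply B x" for x
  proof -
    have "blinfun_apply Y x = (1/2) *\<^sub>R (blinfun_apply B x + blinfun_apply Y (blinfun_apply Y x))"
      using arg_cong[OF Y(3), of "\<lambda>Z. blinfun_apply Z x"] by (simp add: blinfun.bilinear_simps)
    then have "2 *\<^sub>R blinfun_apply Y x = blinfun_apply B x + blinfun_apply Y (blinfun_apply Y x)"
      by (metis (no_types, lifting) scaleR_half_double scaleR_2 scaleR_scaleR mult.commute scaleR_right_distrib)
    then show ?thesis by simp
  qed
  define P where "P x = K *\<^sub>R (x - blinfun_apply Y x)" for x
  have Pc: "P (c *\<^sub>C x) = c *\<^sub>C P x" for c x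
    using Y(1) by (simp add: P_def S_def scaleC_scaleR scaleC_diff_right)
  have Psym: "P x \<bullet> y = x \<bullet> P y" for x y
    using Y(1) by (simp add: P_def S_def inner_diff)
  have "bounded_linear P"
    unfolding P_def by (intro bounded_linear_intros)
  moreover have "cinner (P x) x \<in> \<real>\<^sub>\<ge>\<^sub>0" for x
  proof -
    have "blinfun_apply Y x \<bullet> x \<le> norm (blinfun_apply Y x) * norm x" by (rule norm_cauchy_schwarz)
    also have "\<dots> \<le> 1 * norm x * norm x"
      using order_trans[OF norm_blinfun mult_right_mono[OF Y(2) norm_ge_zero]]
      by (intro mult_right_mono) auto
    finally have "0 \<le> P x \<bullet> x"
      using K(1) by (simp add: P_def inner_diff dot_square_norm power2_eq_square)
    moreover have "(\<i> *\<^sub>C P x) \<bullet> x = 0"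
    proof -
      have "(\<i> *\<^sub>C P x) \<bullet> x = (\<i> *\<^sub>C x) \<bullet> P x" by (simp add: Psym Pc[symmetric])
      also have "\<dots> = - ((\<i> *\<^sub>C P x) \<bullet> x)" by (subst inner_ii_left) (simp add: inner_commute)
      finally show ?thesis by simp
    qed
    ultimately show ?thesis by (simp add: cinner_eq_Complex complex_nonneg_Reals_iff)
  qed
  moreover have "P (P x) = cadjoint A (A x)" for x
  proof -
    have "P (P x) = (K * K) *\<^sub>R (x - 2 *\<^sub>R blinfun_apply Y x + blinfun_apply Y (blinfun_apply Y x))"
      by (simp add: P_def blinfun.bilinear_simps algebra_simps scaleR_2)
    also have "\<dots> = (K * K) *\<^sub>R (1 / K\<^sup>2) *\<^sub>R T x" by (simp add: Yeq B)
    finally show ?thesis using K(1) by (simp add: T_def power2_eq_square)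
  qed
  ultimately show ?thesis
    by (intro exI[of _ P]) (auto simp: positive_operator_def bounded_clinear_def Pc)
qed

lemma operator_abs:
  fixes A :: "'a::chilbert_space \<Rightarrow> 'b::chilbert_space"
  assumes "bounded_clinear A"
  shows "positive_operator (operator_abs A)" and "operator_abs A (operator_abs A x) = cadjoint A (A x)"
  using someI_ex[OF operator_sqrt_exists[OF assms]]
  unfolding operator_abs_def operator_sqrt_def by (auto dest: fun_cong)

lemma norm_operator_abs:
  fixes A :: "'a::chilbert_space \<Rightarrow> 'b::chilbert_space"
  assumes "bounded_clinear A"
  shows "norm (operator_abs A x) = norm (A x)"
proof -
  have "operator_abs A x \<bullet> operator_abs A x = A x \<bullet> A x"
    using positive_operator_symmetric[OF operator_abs(1)[OF assms]]
    by (simp add: operator_abs(2)[OF assms] cadjoint_inner[OF assms])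
  then show ?thesis by (simp add: norm_eq_sqrt_inner)
qed

section \<open>The spectral gap\<close>

text \<open>The lower bound gives injectivity and a closed range; by symmetry a vector orthogonal to
  the range lies in the kernel, which is zero.\<close>

lemma symmetric_bounded_below_surj:
  fixes G :: "'a::{real_inner,banach} \<Rightarrow> 'a"
  assumes G: "bounded_linear G" and sym: "\<And>x y. G x \<bullet> y = x \<bullet> G y"
    and e: "0 < e" and low: "\<And>x. e * norm x \<le> norm (G x)"
  shows "bij G"
proof -
  interpret G: bounded_linear G by fact
  have "x = 0" if "G x = 0" for x
    using low[of x] that e by (simp add: mult_le_0_iff)
  then have inj: "inj G" using linear_injective_0[OF G.linear] by blast
  have "complete (range G)"
    by (rule complete_isometric_image[OF e subspace_UNIV G]) (use low complete_UNIV in auto)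
  then have cl: "closed (range G)" by (simp add: complete_eq_closed)
  have sub: "subspace (range G)" by (rule linear_subspace_image[OF G.linear subspace_UNIV])
  have "x \<in> range G" for x
  proof -
    let ?r = "x - proj (range G) x"
    have "G ?r \<bullet> y = 0" for y using proj_orth[OF sub cl, of "G y" x] by (simp add: sym)
    from this[of "G ?r"] have "G ?r = 0" by simp
    then have "?r = 0" using low[of ?r] e by (simp add: mult_le_0_iff)
    then show ?thesis using proj_in[OF sub cl, of x] by simp
  qed
  then show ?thesis using inj by (auto simp: bij_def)
qed

lemma notin_op_spectrum:
  fixes H :: "'a::chilbert_space \<Rightarrow> 'a"
  assumes H: "positive_operator H" and e: "0 < e"
    and low: "\<And>x. e * norm x \<le> norm (H x - t *\<^sub>R x)"
  shows "complex_of_real t \<notin> op_spectrum H"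
proof -
  define G where "G x = H x - t *\<^sub>R x" for x
  have cl: "bounded_clinear H" using H by (simp add: positive_operator_def)
  have G: "bounded_linear G"
    unfolding G_def by (intro bounded_linear_sub bounded_linear_clinear[OF cl] bounded_linear_scaleR_right)
  interpret G: bounded_linear G by fact
  have Gc: "G (c *\<^sub>C x) = c *\<^sub>C G x" for c x
    by (simp add: G_def clinear_scaleC[OF cl] scaleC_diff_right scaleC_scaleR)
  have lowG: "e * norm x \<le> norm (G x)" for x using low by (simp add: G_def)
  have "bij G"
    by (rule symmetric_bounded_below_surj[OF G _ e lowG])
      (simp add: G_def inner_diff positive_operator_symmetric[OF H])
  then have 1: "inv G (G x) = x" and 2: "G (inv G x) = x" for x
    by (simp_all add: bij_is_inj bij_is_surj surj_f_inv_f)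
  have invI: "inv G y = x" if "G x = y" for x y using 1 that by blast
  have "bounded_clinear (inv G)"
    unfolding bounded_clinear_def
  proof (intro conjI allI)
    show "bounded_linear (inv G)"
    proof (rule bounded_linear_intro[where K="1/e"])
      show "norm (inv G x) \<le> norm x * (1 / e)" for x
        using lowG[of "inv G x"] e 2 by (simp add: field_simps)
    qed (auto intro!: invI simp: 2 G.add G.scaleR)
    show "inv G (c *\<^sub>C x) = c *\<^sub>C inv G x" for c x
      by (rule invI) (simp add: Gc 2)
  qed
  moreover have "(\<lambda>x. H x - complex_of_real t *\<^sub>C x) = G" by (simp add: G_def scaleC_of_real fun_eq_iff)
  moreover have "inv G \<circ> G = id" "G \<circ> inv G = id" using 1 2 by (auto simp: fun_eq_iff)
  ultimately show ?thesis unfolding op_spectrum_def by auto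
qed

text \<open>The inequality \<open>G\<^sup>2 \<le> g G\<close>, read off from nonnegativity of the
  form at \<open>x - (1 / g) G x\<close>. Positivity is asked only on \<open>M\<close>, since
  \<open>H - m\<close> below is negative on the kernel of \<open>H\<close>.\<close>

lemma positive_on_subspace_norm_le:
  fixes G :: "'a::real_inner \<Rightarrow> 'a"
  assumes "bounded_linear G" and sym: "\<And>x y. G x \<bullet> y = x \<bullet> G y"
    and M: "subspace M" "\<And>x. x \<in> M \<Longrightarrow> G x \<in> M" and pos: "\<And>x. x \<in> M \<Longrightarrow> 0 \<le> G x \<bullet> x"
    and g: "0 < g" "\<And>x. norm (G x) \<le> g * norm x" and x: "x \<in> M"
  shows "(norm (G x))\<^sup>2 \<le> g * (G x \<bullet> x)"
proof -
  interpret G: bounded_linear G by fact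
  let ?y = "x - (1 / g) *\<^sub>R G x"
  have exp: "G (x - s *\<^sub>R G x) \<bullet> (x - s *\<^sub>R G x)
      = G x \<bullet> x - 2 * (s * (G x \<bullet> G x)) + s * s * (G (G x) \<bullet> G x)" for s
    by (simp add: G.diff G.scaleR inner_diff inner_commute sym algebra_simps)
  have "G (G x) \<bullet> G x \<le> norm (G (G x)) * norm (G x)" by (rule norm_cauchy_schwarz)
  also have "\<dots> \<le> g * norm (G x) * norm (G x)" by (intro mult_right_mono g) simp
  finally have "(1/g) * (1/g) * (G (G x) \<bullet> G x) \<le> (1/g) * (1/g) * (g * (norm (G x))\<^sup>2)"
    by (intro mult_left_mono) (auto simp: power2_eq_square mult.assoc)
  also have "\<dots> = (1/g) * (norm (G x))\<^sup>2" using g(1) by simp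
  finally have "(1/g) * (1/g) * (G (G x) \<bullet> G x) \<le> (1/g) * (norm (G x))\<^sup>2" .
  moreover have "?y \<in> M" using M x by (simp add: subspace_diff subspace_scale)
  then have "0 \<le> G x \<bullet> x - 2 * ((1/g) * (G x \<bullet> G x)) + (1/g) * (1/g) * (G (G x) \<bullet> G x)"
    using pos exp by metis
  ultimately have "(1/g) * (norm (G x))\<^sup>2 \<le> G x \<bullet> x" unfolding power2_norm_eq_inner by linarith
  then show ?thesis using g(1) by (simp add: field_simps)
qed

text \<open>The infimum \<open>m\<close> of the quadratic form over unit vectors orthogonal to the
  kernel belongs to the spectrum, while \<open>c\<close> bounds the nonzero real spectrum from
  below. Hence the smallest positive spectral value lies between \<open>c\<close> and
  \<open>m\<close>.\<close>

lemma min_pos_spectral_value_gap: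
  fixes H :: "'a::chilbert_space \<Rightarrow> 'a"
  assumes H: "positive_operator H" and ne: "H \<noteq> (\<lambda>x. 0)"
    and c: "0 < c" "\<And>x. (\<And>n. H n = 0 \<Longrightarrow> x \<bullet> n = 0) \<Longrightarrow> c * norm x \<le> norm (H x)"
  shows "0 < min_pos_spectral_value H"
    and "(\<And>n. H n = 0 \<Longrightarrow> x \<bullet> n = 0) \<Longrightarrow> min_pos_spectral_value H * (norm x)\<^sup>2 \<le> H x \<bullet> x"
proof -
  have cl: "bounded_clinear H" using H by (simp add: positive_operator_def)
  have bl: "bounded_linear H" by (rule bounded_linear_clinear[OF cl])
  interpret H: bounded_linear H by (rule bl)
  note sym = positive_operator_symmetric[OF H]
  define N where "N = {n. H n = 0}"
  define M where "M = {x. \<forall>n\<in>N. x \<bullet> n = 0}"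
  define S where "S = {t. complex_of_real t \<in> op_spectrum H - {0}}"
  have N: "subspace N" "closed N" unfolding N_def by (rule subspace_zero_set[OF bl] closed_zero_set[OF bl])+
  have M: "subspace M" unfolding M_def by (rule subspace_inner_compl)
  have HM: "H x \<in> M" for x by (simp add: M_def N_def sym)
  have cM: "c * norm x \<le> norm (H x)" if "x \<in> M" for x
    by (rule c(2)) (use that in \<open>auto simp: M_def N_def\<close>)
  obtain h where h: "0 < h" "\<And>x. norm (H x) \<le> h * norm x"
    using H.pos_bounded by (metis mult.commute)

  have pythagoras: "(norm (a - s *\<^sub>R b))\<^sup>2 = (norm a)\<^sup>2 + (s * norm b)\<^sup>2"
    if "a \<bullet> b = 0" for a b :: 'a and s
    unfolding power_mult_distrib power2_norm_eq_inner
    using that by (simp add: inner_diff inner_commute[of b a] power2_eq_square[of s])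
  have lowS: "c \<le> t" if tS: "t \<in> S" for t
  proof (rule ccontr)
    assume tc: "\<not> c \<le> t"
    have t0: "t \<noteq> 0" using tS by (auto simp: S_def)
    have "\<exists>e>0. \<forall>x. e * norm x \<le> norm (H x - t *\<^sub>R x)"
    proof (cases "t < 0")
      case True
      have "(- t) * norm x \<le> norm (H x - t *\<^sub>R x)" for x
      proof (cases "x = 0")
        case False
        have "(- t) * norm x * norm x \<le> (H x - t *\<^sub>R x) \<bullet> x"
          using positive_operator_inner_nonneg[OF H, of x]
          by (simp add: inner_diff dot_square_norm power2_eq_square)
        also have "\<dots> \<le> norm (H x - t *\<^sub>R x) * norm x" by (rule norm_cauchy_schwarz)
        finally have *: "(- t) * norm x * norm x \<le> norm (H x - t *\<^sub>R x) * norm x" .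
        show ?thesis by (rule mult_right_le_imp_le[OF *]) (use False in simp)
      qed simp
      then show ?thesis using True by (intro exI[of _ "- t"]) auto
    next
      case False
      \<comment> \<open>On the kernel \<open>H - t\<close> acts as \<open>- t\<close>; on the
        complement it is bounded below by \<open>c - t\<close>. These parts are orthogonal, so the
        smaller constant works on the whole space.\<close>
      define e where "e = min t (c - t)"
      have e: "0 < e" "e \<le> t" "e \<le> c - t" using False t0 tc by (auto simp: e_def)
      have "e * norm x \<le> norm (H x - t *\<^sub>R x)" for x
      proof -
        let ?n = "proj N x"
        let ?p = "x - ?n"
        let ?q = "H ?p - t *\<^sub>R ?p"
        have n: "?n \<in> N" by (rule proj_in[OF N])
        have p: "?p \<in> M" unfolding M_def using proj_orth[OF N] by simp
        have q: "?q \<in> M" using HM p M by (simp add: subspace_diff subspace_scale)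
        have "H x = H ?p" using n by (simp add: H.diff N_def)
        then have split: "H x - t *\<^sub>R x = ?q - t *\<^sub>R ?n" by (simp add: algebra_simps)
        have "?q \<bullet> ?n = 0" using q n unfolding M_def by blast
        then have sq: "(norm (H x - t *\<^sub>R x))\<^sup>2 = (norm ?q)\<^sup>2 + (t * norm ?n)\<^sup>2"
          unfolding split by (rule pythagoras)
        have "e * norm ?p \<le> (c - t) * norm ?p" using e by (intro mult_right_mono) auto
        also have "\<dots> \<le> norm (H ?p) - norm (t *\<^sub>R ?p)"
          using cM[OF p] False by (simp add: left_diff_distrib)
        also have "\<dots> \<le> norm ?q" by (rule norm_triangle_ineq2)
        finally have "(e * norm ?p)\<^sup>2 \<le> (norm ?q)\<^sup>2" using e by (intro power_mono) auto
        moreover have "(e * norm ?n)\<^sup>2 \<le> (t * norm ?n)\<^sup>2"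
          using e by (intro power_mono mult_right_mono) auto
        ultimately have "(e * norm x)\<^sup>2 \<le> (norm (H x - t *\<^sub>R x))\<^sup>2"
          unfolding sq power_mult_distrib[of e] norm_proj_sum[OF N, of x] by (simp add: distrib_left)
        then show ?thesis by (rule power2_le_imp_le) simp
      qed
      then show ?thesis using e by blast
    qed
    then show False using notin_op_spectrum[OF H] tS by (auto simp: S_def)
  qed

  define V where "V = {H x \<bullet> x | x. x \<in> M \<and> norm x = 1}"
  define m where "m = Inf V"
  have bddV: "bdd_below V" by (rule bdd_belowI[of _ 0]) (auto simp: V_def positive_operator_inner_nonneg[OF H])
  obtain x0 where "H x0 \<noteq> 0" using ne by auto
  then have "(1 / norm (H x0)) *\<^sub>R H x0 \<in> M \<and> norm ((1 / norm (H x0)) *\<^sub>R H x0) = 1"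
    using HM M by (simp add: subspace_scale)
  then have neV: "V \<noteq> {}" unfolding V_def by blast
  have mV: "m * (norm x)\<^sup>2 \<le> H x \<bullet> x" if "x \<in> M" for x
  proof (cases "x = 0")
    case False
    let ?u = "(1 / norm x) *\<^sub>R x"
    have "H ?u \<bullet> ?u \<in> V" unfolding V_def using that M False by (auto simp: subspace_scale intro!: exI[of _ ?u])
    then have "m \<le> H ?u \<bullet> ?u" unfolding m_def using bddV by (rule cInf_lower)
    also have "\<dots> = (H x \<bullet> x) / (norm x)\<^sup>2" by (simp add: H.scaleR power2_eq_square)
    finally show ?thesis using False by (simp add: field_simps)
  qed simp
  have "c\<^sup>2 / h \<le> m" unfolding m_def
  proof (rule cInf_greatest[OF neV])
    fix v assume "v \<in> V"
    then obtain x where x: "x \<in> M" "norm x = 1" "v = H x \<bullet> x" by (auto simp: V_def)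
    have "c\<^sup>2 \<le> (norm (H x))\<^sup>2" using cM[OF x(1)] x c(1) by (intro power_mono) auto
    also have "\<dots> \<le> h * (H x \<bullet> x)"
      by (rule positive_on_subspace_norm_le[OF bl sym M HM positive_operator_inner_nonneg[OF H] h x(1)])
    finally show "c\<^sup>2 / h \<le> v" using h x by (simp add: field_simps)
  qed
  then have m0: "0 < m" using c h by (meson divide_pos_pos less_le_trans zero_less_power)
  have mS: "m \<in> S"
  proof (rule ccontr)
    define G where "G x = H x - m *\<^sub>R x" for x
    have G: "bounded_linear G"
      unfolding G_def by (intro bounded_linear_sub bl bounded_linear_scaleR_right)
    assume "m \<notin> S"
    then have "complex_of_real m \<notin> op_spectrum H" using m0 by (simp add: S_def)
    moreover have "(\<lambda>x. H x - complex_of_real m *\<^sub>C x) = G" by (simp add: G_def scaleC_of_real fun_eq_iff)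
    ultimately obtain T where T: "bounded_clinear T" "T \<circ> G = id"
      unfolding op_spectrum_def by auto
    obtain L where L: "0 < L" "\<And>x. norm (T x) \<le> norm x * L"
      using bounded_linear.pos_bounded[OF bounded_linear_clinear[OF T(1)]] by blast
    obtain g where g: "0 < g" "\<And>x. norm (G x) \<le> g * norm x"
      using bounded_linear.pos_bounded[OF G] by (metis mult.commute)
    \<comment> \<open>A bounded left inverse of \<open>G = H - m\<close> keeps
      \<open>norm (G x)\<close> at least \<open>1 / L\<close> on unit vectors. As \<open>G\<close>
      is nonnegative on \<open>M\<close>, its form is then at least
      \<open>1 / (L\<^sup>2 * g)\<close>, which pushes the infimum strictly above
      \<open>m\<close>.\<close>
    have "m + 1 / (L\<^sup>2 * g) \<le> Inf V"
    proof (rule cInf_greatest[OF neV])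
      fix v assume "v \<in> V"
      then obtain x where x: "x \<in> M" "norm x = 1" "v = H x \<bullet> x" by (auto simp: V_def)
      have "norm x \<le> norm (G x) * L" using L(2)[of "G x"] fun_cong[OF T(2), of x] by simp
      then have "1\<^sup>2 \<le> (norm (G x) * L)\<^sup>2" using x by (intro power_mono) auto
      also have "\<dots> = (norm (G x))\<^sup>2 * L\<^sup>2" by (rule power_mult_distrib)
      also have "\<dots> \<le> g * (G x \<bullet> x) * L\<^sup>2"
      proof (intro mult_right_mono positive_on_subspace_norm_le[OF G _ M _ _ g x(1)])
        show "G x \<bullet> y = x \<bullet> G y" for x y by (simp add: G_def inner_diff sym)
        show "G x \<in> M" if "x \<in> M" for x
          using that HM M by (simp add: G_def subspace_diff subspace_scale)
        show "0 \<le> G x \<bullet> x" if "x \<in> M" for x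
          using mV[OF that] by (simp add: G_def inner_diff dot_square_norm)
      qed simp
      also have "G x \<bullet> x = v - m" using x by (simp add: G_def inner_diff dot_square_norm)
      finally have "1 \<le> (v - m) * (L\<^sup>2 * g)" by (simp add: ac_simps)
      moreover have "0 < L\<^sup>2 * g" using L g by simp
      ultimately show "m + 1 / (L\<^sup>2 * g) \<le> v"
        using pos_divide_le_eq[of "L\<^sup>2 * g" 1 "v - m"] by linarith
    qed
    moreover have "0 < 1 / (L\<^sup>2 * g)" using L g by simp
    ultimately show False unfolding m_def by linarith
  qed
  have sv: "min_pos_spectral_value H = Inf S" by (simp add: min_pos_spectral_value_def S_def)
  \<comment> \<open>Membership of \<open>m\<close> makes \<open>S\<close> nonempty, so that its real
    infimum is determined by its elements.\<close>
  have "c \<le> Inf S" using mS lowS by (intro cInf_greatest) auto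
  then show "0 < min_pos_spectral_value H" using c(1) sv by simp
  have "Inf S \<le> m" using mS lowS by (intro cInf_lower bdd_belowI[of _ c])
  then have "Inf S * (norm x)\<^sup>2 \<le> m * (norm x)\<^sup>2" for x :: 'a by (intro mult_right_mono) auto
  then show "min_pos_spectral_value H * (norm x)\<^sup>2 \<le> H x \<bullet> x" if "\<And>n. H n = 0 \<Longrightarrow> x \<bullet> n = 0"
    using mV[of x] that unfolding sv by (fastforce simp: M_def N_def intro: order_trans)
qed

lemma closed_range_polarI:
  fixes A Q :: "'a::chilbert_space \<Rightarrow> 'b::chilbert_space"
  assumes A: "bounded_clinear A" and ne: "A \<noteq> (\<lambda>x. 0)" and cl: "closed (range A)"
    and polar: "polar_decomposition A Q"
  shows "closed_range_polar A Q (operator_abs A) (min_pos_spectral_value (operator_abs A))"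
proof -
  let ?H = "operator_abs A"
  have H: "positive_operator ?H" by (rule operator_abs(1)[OF A])
  note nH = norm_operator_abs[OF A]
  have Q: "bounded_clinear Q" and iso: "\<And>x. x \<in> ortho_compl (kernel Q) \<Longrightarrow> norm (Q x) = norm x"
    and ker: "kernel Q = kernel A" and AQ: "A = Q \<circ> ?H"
    using polar by (auto simp: polar_decomposition_def partial_isometry_def)
  have H0: "?H x = 0 \<longleftrightarrow> A x = 0" for x using nH[of x] by (metis norm_eq_zero)
  obtain c where c: "0 < c" "\<And>x. (\<And>n. A n = 0 \<Longrightarrow> x \<bullet> n = 0) \<Longrightarrow> c * norm x \<le> norm (A x)"
    using closed_range_bounded_below[OF bounded_linear_clinear[OF A] cl] by metis
  have "?H \<noteq> (\<lambda>x. 0)" using ne H0 by (metis ext)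
  note gap = min_pos_spectral_value_gap[OF H this c(1), unfolded nH H0, OF c(2)]
  show ?thesis
  proof (rule closed_range_polar.intro)
    show "A x = Q (?H x)" for x using fun_cong[OF AQ, of x] by simp
    show "Q x = 0 \<longleftrightarrow> A x = 0" for x using ker by (auto simp: kernel_def)
    show "norm (Q x) = norm x" if "\<And>n. A n = 0 \<Longrightarrow> x \<bullet> n = 0" for x
      using that iso ortho_compl_eq[OF csubspace_kernel[OF A]] ker by (simp add: kernel_def)
  qed (use A Q H cl gap nH positive_operator_symmetric[OF H] in
      \<open>auto simp: bounded_linear_clinear positive_operator_def\<close>)
qed

section \<open>Orthonormal bases of complex subspaces\<close>

text \<open>By Zorn: any two vectors in the union of a chain share a member of it. This ensures that
  the choice in \<open>hilbert_dim\<close> picks a basis.\<close>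

lemma orthonormal_basis_exists: "\<exists>B. is_orthonormal_basis S B"
proof -
  let ?F = "{B. orthonormal B \<and> B \<subseteq> S}"
  have "\<exists>M\<in>?F. \<forall>X\<in>?F. M \<subseteq> X \<longrightarrow> X = M"
  proof (rule subset_Zorn')
    fix C assume C: "subset.chain ?F C"
    have "orthonormal (\<Union>C)"
      unfolding orthonormal_def
    proof (intro conjI ballI impI)
      show "norm x = 1" if "x \<in> \<Union>C" for x
        using that C by (auto simp: subset.chain_def orthonormal_def)
      show "cinner x y = 0" if xy: "x \<in> \<Union>C" "y \<in> \<Union>C" "x \<noteq> y" for x y
      proof -
        obtain X Y where X: "x \<in> X" "X \<in> C" and Y: "y \<in> Y" "Y \<in> C" using xy by blast
        then have "X \<subseteq> Y \<or> Y \<subseteq> X" using C by (auto simp: subset_chain_def)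
        then obtain Z where "x \<in> Z" "y \<in> Z" "Z \<in> C" using X Y by blast
        then show ?thesis using C xy(3) by (auto simp: subset_chain_def orthonormal_def)
      qed
    qed
    then show "\<Union>C \<in> ?F" using C by (auto simp: subset_chain_def)
  qed
  then obtain M where "M \<in> ?F" "\<forall>X\<in>?F. M \<subseteq> X \<longrightarrow> X = M" by blast
  then show ?thesis unfolding is_orthonormal_basis_def by blast
qed

text \<open>Passage to real dimension: each \<open>x\<close> is orthogonal to
  \<open>\<i> *\<^sub>C x\<close> in the real inner product, so a complex orthonormal set and its
  rotated copy are disjoint and jointly orthogonal.\<close>

lemma orthonormal_real_independent:
  assumes B: "orthonormal B"
  shows "independent (B \<union> (*\<^sub>C) \<i> ` B)" and "inj_on ((*\<^sub>C) \<i>) B" and "B \<inter> (*\<^sub>C) \<i> ` B = {}"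
proof -
  have n: "x \<bullet> x = 1" if "x \<in> B" for x
    using that B by (simp add: orthonormal_def dot_square_norm)
  have "cinner x y = 0" if "x \<in> B" "y \<in> B" "x \<noteq> y" for x y
    using that B by (auto simp: orthonormal_def)
  then have o: "x \<bullet> y = 0" "(\<i> *\<^sub>C x) \<bullet> y = 0" "x \<bullet> (\<i> *\<^sub>C y) = 0" "(\<i> *\<^sub>C x) \<bullet> (\<i> *\<^sub>C y) = 0"
    if "x \<in> B" "y \<in> B" "x \<noteq> y" for x y
    using that by (simp_all add: Re_cinner[symmetric] cinner_scaleC_left cinner_scaleC_right)
  have s: "(\<i> *\<^sub>C x) \<bullet> x = 0" "x \<bullet> (\<i> *\<^sub>C x) = 0" for x :: 'a
    by (simp_all add: Re_cinner[symmetric] cinner_scaleC_left cinner_scaleC_right cinner_self)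
  have ii: "\<i> *\<^sub>C \<i> *\<^sub>C x = - x" for x :: 'a
    by (simp add: scaleC_scaleC scaleC_minus_left scaleC_one)
  show inj: "inj_on ((*\<^sub>C) \<i>) B"
    by (rule inj_onI) (metis ii neg_equal_iff_equal)
  show dis: "B \<inter> (*\<^sub>C) \<i> ` B = {}"
  proof (intro equalityI subsetI)
    fix z assume "z \<in> B \<inter> (*\<^sub>C) \<i> ` B"
    then obtain x where x: "x \<in> B" "z \<in> B" "z = \<i> *\<^sub>C x" by blast
    have "z \<bullet> z = 0"
      by (cases "z = x") (use x s[of x] o(3)[of z x] in auto)
    then show "z \<in> {}" using n[OF x(2)] by simp
  qed simp
  show "independent (B \<union> (*\<^sub>C) \<i> ` B)"
  proof (rule pairwise_orthogonal_independent)
    show "pairwise orthogonal (B \<union> (*\<^sub>C) \<i> ` B)"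
    proof -
      have "u \<bullet> v = 0" if uv: "u \<in> B \<union> (*\<^sub>C) \<i> ` B" "v \<in> B \<union> (*\<^sub>C) \<i> ` B" "u \<noteq> v" for u v
      proof -
        obtain x where x: "x \<in> B" "u = x \<or> u = \<i> *\<^sub>C x" using uv(1) by blast
        obtain y where y: "y \<in> B" "v = y \<or> v = \<i> *\<^sub>C y" using uv(2) by blast
        show ?thesis
        proof (cases "x = y")
          case True
          then show ?thesis using x(2) y(2) uv(3) s by auto
        next
          case False
          then show ?thesis using x(2) y(2) o[OF x(1) y(1)] by auto
        qed
      qed
      then show ?thesis by (simp add: pairwise_def orthogonal_def)
    qed
    show "0 \<notin> B \<union> (*\<^sub>C) \<i> ` B"
    proof
      assume "0 \<in> B \<union> (*\<^sub>C) \<i> ` B"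
      then obtain x where x: "x \<in> B" "x = 0 \<or> \<i> *\<^sub>C x = 0" by auto
      then have "x = 0" using norm_scaleC[of \<i> x] by auto
      then show False using n[OF x(1)] by simp
    qed
  qed
qed

lemma cinner_sum_left: "cinner (\<Sum>b\<in>B. f b) y = (\<Sum>b\<in>B. cinner (f b) y)"
proof (induction B rule: infinite_finite_induct)
  case (insert b B)
  then show ?case by (simp add: cinner_add_left)
qed (use cinner_add_left[of 0 0 y] in simp_all)

text \<open>If the remainder of the finite Fourier expansion were nonzero, its normalization would
  enlarge the maximal set \<open>B\<close>.\<close>

lemma orthonormal_basis_span:
  assumes G: "csubspace G" and B: "is_orthonormal_basis G B" and fin: "finite B"
  shows "G = span (B \<union> (*\<^sub>C) \<i> ` B)"
proof
  have BG: "B \<subseteq> G" and on: "orthonormal B"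
    and max: "\<And>B'. orthonormal B' \<Longrightarrow> B \<subseteq> B' \<Longrightarrow> B' \<subseteq> G \<Longrightarrow> B' = B"
    using B unfolding is_orthonormal_basis_def by blast+
  have sG: "subspace G" using G by (simp add: csubspace_def)
  show "span (B \<union> (*\<^sub>C) \<i> ` B) \<subseteq> G"
    using BG G by (intro span_minimal sG) (auto simp: csubspace_def)
  show "G \<subseteq> span (B \<union> (*\<^sub>C) \<i> ` B)"
  proof
    fix x assume x: "x \<in> G"
    define p where "p = (\<Sum>b\<in>B. cinner x b *\<^sub>C b)"
    have bb: "cinner b b' = (if b = b' then 1 else 0)" if "b \<in> B" "b' \<in> B" for b b'
      using that on by (auto simp: orthonormal_def cinner_self)
    have pG: "p \<in> G" unfolding p_def using BG G by (intro subspace_sum sG) (auto simp: csubspace_def)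
    have psp: "p \<in> span (B \<union> (*\<^sub>C) \<i> ` B)"
      unfolding p_def scaleC_complex_split[of "cinner x _"]
      by (intro span_sum span_add span_scale span_base) auto
    have orth: "cinner (x - p) b = 0" if b: "b \<in> B" for b
    proof -
      have "cinner p b = (\<Sum>b'\<in>B. cinner x b' * cinner b' b)"
        by (simp add: p_def cinner_sum_left cinner_scaleC_left)
      also have "\<dots> = (\<Sum>b'\<in>B. if b' = b then cinner x b' else 0)"
        using bb b by (intro sum.cong) auto
      also have "\<dots> = cinner x b" using fin b by simp
      finally show ?thesis using cinner_add_left[of "x - p" p b] by simp
    qed
    have "x - p = 0"
    proof (rule ccontr)
      assume r: "x - p \<noteq> 0"
      let ?u = "(1 / norm (x - p)) *\<^sub>R (x - p)"
      have u: "norm ?u = 1" using r by simp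
      have ub: "cinner ?u b = 0" if "b \<in> B" for b
        using orth[OF that] by (simp add: scaleC_of_real[symmetric] cinner_scaleC_left)
      have bu: "cinner b ?u = 0" if "b \<in> B" for b
        using ub[OF that] cinner_commute[of b ?u] by simp
      have "orthonormal (insert ?u B)"
        using on u ub bu by (simp add: orthonormal_def)
      moreover have "?u \<in> G" using x pG sG by (simp add: subspace_scale subspace_diff)
      ultimately have "?u \<in> B" using max[of "insert ?u B"] BG by blast
      then have "cinner ?u ?u = 0" by (rule ub)
      then show False using u by (simp add: cinner_self)
    qed
    then show "x \<in> span (B \<union> (*\<^sub>C) \<i> ` B)" using psp by simp
  qed
qed

lemma equidimensionalI:
  fixes G1 G2 :: "'a::complex_inner set"
  assumes G1: "csubspace G1" and G2: "csubspace G2"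
    and eq: "hilbert_dim G1 =o hilbert_dim G2" and fin: "finite (Field (hilbert_dim G1)) \<or> finite (Field (hilbert_dim G2))"
  shows "equidimensional G1 G2"
proof -
  define B where "B G = (SOME B. is_orthonormal_basis G B)" for G :: "'a set"
  have B: "is_orthonormal_basis G (B G)" for G
    unfolding B_def by (rule someI_ex[OF orthonormal_basis_exists])
  have dim: "hilbert_dim G = |B G|" for G by (simp add: hilbert_dim_def B_def)
  obtain f where f: "bij_betw f (B G1) (B G2)"
    using eq unfolding dim card_of_ordIso[symmetric] by blast
  then have finB: "finite (B G1)" "finite (B G2)"
    using fin bij_betw_finite[OF f] by (auto simp: dim Field_card_of)
  have card: "card (B G1) = card (B G2)" by (rule bij_betw_same_card[OF f])
  let ?R = "\<lambda>B. B \<union> (*\<^sub>C) \<i> ` B"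
  have on: "orthonormal (B G)" for G using B unfolding is_orthonormal_basis_def by blast
  have cardR: "card (?R (B G)) = 2 * card (B G)" if "finite (B G)" for G
    using that orthonormal_real_independent(2,3)[OF on, of G]
    by (simp add: card_Un_disjoint card_image)
  show ?thesis
    unfolding equidimensional_def
    using finB card cardR orthonormal_real_independent(1)[OF on]
      orthonormal_basis_span[OF G1 B finB(1)] orthonormal_basis_span[OF G2 B finB(2)]
    by (intro exI[of _ "?R (B G1)"] exI[of _ "?R (B G2)"]) simp
qed

section \<open>Transfer of the real estimate to complex Hilbert spaces\<close>

theorem theorem1p1:
  fixes A1 A2 Q1 Q2 :: "'h::chilbert_space \<Rightarrow> 'k::chilbert_space"
  assumes "bounded_clinear A1" and "bounded_clinear A2"
    and "A1 \<noteq> (\<lambda>x. 0)" and "A2 \<noteq> (\<lambda>x. 0)"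
    and "semi_fredholm A1" and "semi_fredholm A2"
    and "nul A1 =o nul A2"
    and "deficiency A1 =o deficiency A2"
    and "polar_decomposition A1 Q1" and "polar_decomposition A2 Q2"
  shows "onorm (\<lambda>x. Q1 x - Q2 x) \<le>
    4 / (min_pos_spectral_value (operator_abs A1) + min_pos_spectral_value (operator_abs A2))
      * onorm (\<lambda>x. A1 x - A2 x)"
proof -
  let ?D = "onorm (\<lambda>x. A1 x - A2 x)"
  let ?s1 = "min_pos_spectral_value (operator_abs A1)"
  let ?s2 = "min_pos_spectral_value (operator_abs A2)"
  have bl: "bounded_linear (\<lambda>x. A1 x - A2 x)"
    using assms(1,2) by (intro bounded_linear_sub bounded_linear_clinear)
  have D: "norm (A1 x - A2 x) \<le> ?D * norm x" for x by (rule onorm[OF bl])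
  have D0: "0 \<le> ?D" by (rule onorm_pos_le[OF bl])
  have crp1: "closed_range_polar A1 Q1 (operator_abs A1) ?s1"
    and crp2: "closed_range_polar A2 Q2 (operator_abs A2) ?s2"
    using assms by (auto intro!: closed_range_polarI simp: semi_fredholm_def)
  have ker: "csubspace (kernel A1)" "csubspace (kernel A2)"
    using assms(1,2) by (auto intro: csubspace_kernel)
  have ran: "csubspace (range A1)" "csubspace (range A2)"
    using assms(1,2) by (auto intro: csubspace_range)
  \<comment> \<open>The finite index selects the alternative, and equality of the cardinals
    transfers finiteness to the other operator.\<close>
  have "equidimensional (kernel A1) (kernel A2) \<or>
      equidimensional (ortho_compl (range A1)) (ortho_compl (range A2))"
    using assms(5-8) equidimensionalI[OF ker]
      equidimensionalI[OF ran[THEN csubspace_ortho_compl]]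
    unfolding semi_fredholm_def nul_def deficiency_def by blast
  then have dim: "equidimensional {x. A1 x = 0} {x. A2 x = 0} \<or>
      equidimensional {x. \<forall>r\<in>range A1. x \<bullet> r = 0} {x. \<forall>r\<in>range A2. x \<bullet> r = 0}"
    unfolding kernel_def ran[THEN ortho_compl_eq] .
  have "0 < ?s1" "0 < ?s2" using crp1 crp2 by (auto dest: closed_range_polar.gap_pos)
  then have "0 \<le> 4 / (?s1 + ?s2) * ?D" using D0 by simp
  then show ?thesis
    by (rule onorm_bound) (use polar_perturbation[OF crp1 crp2 D D0 dim] in simp)
qed

end
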